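(* Let $N\ge1$ be an integer and $\nu\in\{0,1\}$. The vector of Eichler integrals $\mathsf{EI}^{(\nu)}_N$ is reconstructed via median resummation of its asymptotic series $\widetilde{\mathsf{EI}}{}^{(\nu)}_N$ as $\tau\to0$ with $\mathrm{Im}(\tau)>0$: component-wise, $$\mathcal S^{\mathrm{med}}_{\pi/2}\big[\widetilde{\mathsf{EI}}{}^{(\nu)}_N\big](\tau)=\mathsf{EI}^{(\nu)}_N(\tau)-\delta_{\nu,0}\,\frac{i}{\pi\tau}\,\boldsymbol 1,\qquad\tau\in\mathbb H,$$ where $\boldsymbol1=(1,\dots,1)$.
   Context: $\mathbb H$ is the upper half-plane, $q=e^{2\pi i\tau}$, $\delta_{k,n\,(2N)}=1$ if $n\equiv k\pmod{2N}$ and $0$ otherwise. $\widetilde G^{(0)}_N=\{0,1,\dots,N\}$, $\widetilde G^{(1)}_N=\{1,\dots,N-1\}$; all vectors are indexed by $\widetilde G^{(\nu)}_N$. $\mathsf{EI}^{(\nu)}_N=(\mathsf{EI}[\theta^{(\nu)}_{N,k}])_k$ with $$\mathsf{EI}[\theta^{(\nu)}_{N,k}](\tau)=\sum_{n\in\mathbb Z}\mathrm{sgn}(n)\,n^{1-\nu}\,\delta_{k,n\,(2N)}\,q^{n^2/4N}.$$ Asymptotic series: $\widetilde{\mathsf{EI}}{}^{(\nu)}_N(\tau)=\sum_{\ell\ge0}\mathbf c^{(\nu)}_\ell\tau^\ell$ (the asymptotic expansion of $\mathsf{EI}^{(0)}_N(\tau)-\frac{i}{\pi\tau}\boldsymbol1$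 for $\nu=0$ and of $\mathsf{EI}^{(1)}_N(\tau)$ for $\nu=1$), where $\mathbf c^{(\nu)}_\ell=(c^{(\nu)}_{k,\ell})_k$, $$c^{(0)}_{k,\ell}=\frac{2}{\pi\sqrt{2iN}}\left(\frac{2N}{\pi i}\right)^{3/2+\ell}\Gamma\left(\tfrac32+\ell\right)\sum_{m\ge1}\frac{\cos(\pi km/N)}{m^{2\ell+2}},\qquad c^{(1)}_{k,\ell}=\frac{2i}{\pi\sqrt{2iN}}\left(\frac{2N}{\pi i}\right)^{1/2+\ell}\Gamma\left(\tfrac12+\ell\right)\sum_{m\ge1}\frac{\sin(\pi km/N)}{m^{2\ell+1}}.$$ Resummation. Let $\eta=3/2-\nu$. With $\mathcal B[\tau^a](\xi)=\xi^{a-1}/\Gamma(a)$ for $a>0$ (extended term by term and analytically continued), set $s_\theta[\tau^\eta f](\tau)=\int_{e^{i\theta}\mathbb R_{\ge0}}e^{-\xi/\tau}\,\mathcal B[\tau^\eta f](\xi)\,d\xi$ and $s_\theta[f](\tau)=\tau^{-\eta}s_\theta[\tau^\eta f](\tau)$, applied component-wise. The median resummation at angle $\theta$ is $\mathcal S^{\mathrm{med}}_\theta[f](\tau)=\tfrac12\big(s_{\theta_+}[f](\tau)+s_{\theta_-}[f](\tau)\big)$, where $\theta_\pm=\theta\pm\epsilon$ with $\epsilon>0$ small (depending on $\tau$); it is defined for $\mathrm{Re}(e^{-i\theta}\tau)>0$, which for $\theta=\pi/2$ is $\mathbb H$. *)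

theory Defs
  imports
    "HOL-Complex_Analysis.Complex_Analysis"
    "HOL-Number_Theory.Cong"
begin

definition index_set :: "nat \<Rightarrow> nat \<Rightarrow> nat set" where
  "index_set \<nu> N = (if \<nu> = 0 then {0..N} else {1..N - 1})"

text \<open>The rational power of \<open>q\<close> is read as
  \<open>q\<^sup>r = exp (2 \<pi> i r \<tau>)\<close>.\<close>

definition EI :: "nat \<Rightarrow> nat \<Rightarrow> nat \<Rightarrow> complex \<Rightarrow> complex" where
  "EI \<nu> N k \<tau> =
     (\<Sum>\<^sub>\<infinity>n\<in>(UNIV :: int set).
        of_int (sgn n) * of_int n ^ (1 - \<nu>)
        * (if [n = int k] (mod 2 * int N) then 1 else 0)
        * exp (2 * of_real pi * \<i> * \<tau> * (of_int n ^ 2 / (4 * of_nat N))))"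

text \<open>All roots and complex powers are principal. For \<open>\<nu> = 1\<close>, \<open>l = 0\<close> the series over \<open>m\<close>
  converges only conditionally, so it is taken in its natural order; the summation index is shifted
  to start at \<open>0\<close>.\<close>

definition EI_coeff :: "nat \<Rightarrow> nat \<Rightarrow> nat \<Rightarrow> nat \<Rightarrow> complex" where
  "EI_coeff \<nu> N k l =
     (if \<nu> = 0 then
        2 / (of_real pi * csqrt (2 * \<i> * of_nat N))
        * (2 * of_nat N / (of_real pi * \<i>)) powr (3/2 + of_nat l)
        * Gamma (3/2 + of_nat l)
        * of_real (\<Sum>m. cos (pi * real k * real (Suc m) / real N) / real (Suc m) ^ (2 * l + 2))
      else
        2 * \<i> / (of_real pi * csqrt (2 * \<i> * of_nat N))
        * (2 * of_nat N / (of_real pi * \<i>)) powr (1/2 + of_nat l)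
        * Gamma (1/2 + of_nat l)
        * of_real (\<Sum>m. sin (pi * real k * real (Suc m) / real N) / real (Suc m) ^ (2 * l + 1)))"

definition EI_series :: "nat \<Rightarrow> nat \<Rightarrow> nat \<Rightarrow> complex fps" where
  "EI_series \<nu> N k = Abs_fps (EI_coeff \<nu> N k)"

definition continues_on :: "complex fps \<Rightarrow> complex set \<Rightarrow> (complex \<Rightarrow> complex) \<Rightarrow> bool" where
  "continues_on F U g \<longleftrightarrow>
     open U \<and> 0 \<in> U \<and> (\<forall>z\<in>U. closed_segment 0 z \<subseteq> U) \<and>
     g holomorphic_on U \<and> g has_fps_expansion F"

text \<open>The Mittag-Leffler star of \<open>F\<close>, and the continuation of \<open>F\<close> to it. Since star-shaped
  neighbourhoods of the origin have star-shaped, hence connected, intersections, the continued value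
  does not depend on the choice of \<open>U\<close> and \<open>g\<close>.\<close>

definition ml_star :: "complex fps \<Rightarrow> complex set" where
  "ml_star F = \<Union>{U. \<exists>g. continues_on F U g}"

definition continuation :: "complex fps \<Rightarrow> complex \<Rightarrow> complex" where
  "continuation F \<xi> = (THE w. \<exists>U g. continues_on F U g \<and> \<xi> \<in> U \<and> g \<xi> = w)"

lemma continuation_eqI:
  assumes "continues_on F U g" "\<xi> \<in> U"
  shows "continuation F \<xi> = g \<xi>"
proof -
  have "h \<xi> = g \<xi>" if h: "continues_on F V h" "\<xi> \<in> V" for V h
  proof -
    let ?W = "U \<inter> V"
    have star: "\<forall>z\<in>?W. closed_segment 0 z \<subseteq> ?W" and op: "open ?W" and zero: "0 \<in> ?W"
      using assms h by (auto simp: continues_on_def)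
    have con: "connected ?W"
      using star zero by (intro starlike_imp_connected) (auto simp: starlike_def)
    have "g has_fps_expansion F" "h has_fps_expansion F"
      using assms h by (auto simp: continues_on_def)
    then have "\<forall>\<^sub>F z in nhds 0. g z = h z"
      unfolding has_fps_expansion_def by (auto elim: eventually_elim2)
    then obtain S where S: "open S" "0 \<in> S" "\<And>z. z \<in> S \<Longrightarrow> g z = h z"
      unfolding eventually_nhds by blast
    have "g \<xi> = h \<xi>"
    proof (rule analytic_continuation_open[of "S \<inter> ?W" ?W g h])
      show "g holomorphic_on ?W" "h holomorphic_on ?W"
        using assms h by (auto simp: continues_on_def intro: holomorphic_on_subset)
    qed (use S op zero con assms h in auto)
    then show ?thesis ..
  qed
  then show ?thesis
    unfolding continuation_def using assms by (intro the_equality) blast+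
qed

text \<open>\<open>\<B>[\<tau>\<^sup>\<eta> f](\<xi>) = \<xi>\<^sup>\<eta>\<^sup>-\<^sup>1 (\<Sum>l. f\<^sub>l \<xi>\<^sup>l / \<Gamma>(l + \<eta>))\<close>, the power series being continued analytically.
  Powers of \<open>\<xi>\<close> and \<open>\<tau>\<close> are principal; for median sums at \<open>\<theta> = \<pi>/2\<close> the directions \<open>\<theta> \<plusminus> \<epsilon>\<close> and
  the half-plane \<open>Im \<tau> > 0\<close> avoid the branch cut.\<close>

definition borel_fps :: "real \<Rightarrow> complex fps \<Rightarrow> complex fps" where
  "borel_fps \<eta> f = Abs_fps (\<lambda>l. fps_nth f l / Gamma (of_nat l + of_real \<eta>))"

definition borel_transform :: "real \<Rightarrow> complex fps \<Rightarrow> complex \<Rightarrow> complex" where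
  "borel_transform \<eta> f \<xi> = \<xi> powr of_real (\<eta> - 1) * continuation (borel_fps \<eta> f) \<xi>"

text \<open>The Laplace integral along \<open>\<xi> = r e\<^sup>i\<^sup>\<theta>\<close>, \<open>r \<ge> 0\<close>, so that \<open>d\<xi> = e\<^sup>i\<^sup>\<theta> dr\<close>.\<close>

definition laplace_integrand :: "real \<Rightarrow> real \<Rightarrow> complex fps \<Rightarrow> complex \<Rightarrow> real \<Rightarrow> complex" where
  "laplace_integrand \<theta> \<eta> f \<tau> r =
     exp (- (of_real r * cis \<theta>) / \<tau>) * borel_transform \<eta> f (of_real r * cis \<theta>) * cis \<theta>"

definition borel_summable :: "real \<Rightarrow> real \<Rightarrow> complex fps \<Rightarrow> complex \<Rightarrow> bool" where
  "borel_summable \<theta> \<eta> f \<tau> \<longleftrightarrow>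
     (\<forall>r\<ge>0. of_real r * cis \<theta> \<in> ml_star (borel_fps \<eta> f)) \<and>
     set_integrable lborel {0..} (laplace_integrand \<theta> \<eta> f \<tau>)"

definition borel_sum :: "real \<Rightarrow> real \<Rightarrow> complex fps \<Rightarrow> complex \<Rightarrow> complex" where
  "borel_sum \<theta> \<eta> f \<tau> =
     \<tau> powr (- of_real \<eta>) * set_lebesgue_integral lborel {0..} (laplace_integrand \<theta> \<eta> f \<tau>)"

text \<open>The median resummation of \<open>f\<close> at angle \<open>\<theta>\<close> exists at \<open>\<tau>\<close> and equals \<open>S\<close>: for all small
  enough \<open>\<epsilon> > 0\<close> (how small may depend on \<open>\<tau>\<close>) both lateral sums exist and their mean is \<open>S\<close>.\<close>

definition has_median_sum :: "real \<Rightarrow> real \<Rightarrow> complex fps \<Rightarrow> complex \<Rightarrow> complex \<Rightarrow> bool" where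
  "has_median_sum \<theta> \<eta> f \<tau> S \<longleftrightarrow>
     (\<forall>\<^sub>F \<epsilon> in at_right 0.
        borel_summable (\<theta> + \<epsilon>) \<eta> f \<tau> \<and> borel_summable (\<theta> - \<epsilon>) \<eta> f \<tau> \<and>
        (borel_sum (\<theta> + \<epsilon>) \<eta> f \<tau> + borel_sum (\<theta> - \<epsilon>) \<eta> f \<tau>) / 2 = S)"

end

theory Submission
  imports Defs "HOL-Probability.Distributions"
begin

text \<open>Write \<open>x = \<pi> k / N\<close> and \<open>b = 2 N / (\<pi> i)\<close>. Dividing the coefficients of the asymptotic series by the Gamma
values of the Borel transform leaves, for each \<open>n\<close>, a geometric series in the order \<open>l\<close>. Hence, up to a constant
and the factor \<open>\<xi>\<^sup>\<eta>\<^sup>-\<^sup>1\<close>, the Borel transform is \<open>H (b \<xi>)\<close>, where \<open>H w\<close> is the Mittag-Leffler series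
\<open>\<Sum>n\<ge>1. cos (n x) / (n\<^sup>2 - w)\<close> for \<open>\<nu> = 0\<close> and \<open>\<Sum>n\<ge>1. n sin (n x) / (n\<^sup>2 - w)\<close> for \<open>\<nu> = 1\<close>
(\<open>borel_fps_EI_series\<close>, \<open>continues_on_borel_kernel\<close>). Its poles lie on the positive imaginary \<open>\<xi>\<close>-axis, which
is therefore avoided on both sides by the median resummation.

The substitution \<open>b \<xi> = u\<^sup>2\<close> uncovers a symmetry (\<open>lateral_borel_sum\<close>). The directions \<open>\<pi>/2 \<plusminus> \<epsilon>\<close> become rays at angles
\<open>\<plusminus> \<epsilon>/2\<close>, the Laplace kernel becomes the Gaussian \<open>exp (- c u\<^sup>2)\<close> with \<open>c = i \<pi> / (2 N \<tau>)\<close>, and all other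
factors form an even function of \<open>u\<close> that is regular at \<open>0\<close> and has its poles among the nonzero integers. By evenness the lower ray
may be reflected at \<open>0\<close> into the upper half-plane, so the sum of the two lateral integrals is an integral along
one bent line from the upper left through \<open>0\<close> to the upper right, above all poles.

In the upper half-plane \<open>H (u\<^sup>2)\<close> has a closed form by partial fractions (\<open>twisted_partial_fractions\<close>), essentially
\<open>\<pi> cos (u (\<pi> - x)) / sin (\<pi> u)\<close> or \<open>\<pi> sin (u (\<pi> - x)) / sin (\<pi> u)\<close>, and expands into a geometric series of waves
\<open>exp (i y u)\<close> with \<open>y = \<pi> n / N\<close>, where \<open>n \<ge> 0\<close> runs through the numbers congruent to \<open>k\<close> or \<open>- k\<close> modulo \<open>2 N\<close>;
for \<open>\<nu> = 1\<close> the latter carry the sign \<open>- 1\<close>.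
For each wave the bent line may be straightened to the real line
(\<open>gaussian_wave_bent_line\<close>), where the Fourier transform of the Gaussian gives
\<open>exp (- y\<^sup>2 / (4 c)) = q^(n\<^sup>2 / (4 N))\<close>. Summing over \<open>n\<close> by dominated convergence (\<open>bent_line_borel_density\<close>) yields the
Eichler integral; for \<open>\<nu> = 0\<close> the partial fractions contain one further term, which contributes
\<open>- i / (\<pi> \<tau>)\<close>.\<close>

section \<open>Twisted partial fractions\<close>

lemma dirichlet_kernel_cos:
  fixes x :: real
  assumes "sin (x / 2) \<noteq> 0"
  shows "(\<Sum>m<M. cos (real (Suc m) * x)) = sin ((real M + 1/2) * x) / (2 * sin (x / 2)) - 1/2"
proof (induction M)
  case 0
  show ?case using assms by simp
next
  case (Suc M)
  have "sin ((real (Suc M) + 1/2) * x) - sin ((real M + 1/2) * x) = 2 * sin (x/2) * cos (real (Suc M) * x)"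
    by (simp add: sin_diff_sin algebra_simps add_divide_distrib)
  hence "cos (real (Suc M) * x) = (sin ((real (Suc M) + 1/2) * x) - sin ((real M + 1/2) * x)) / (2 * sin (x/2))"
    using assms by (simp add: field_simps)
  with Suc show ?case by (simp add: diff_divide_distrib)
qed

text \<open>The derivative in \<open>x\<close> of the left-hand side is, up to the constant \<open>1/2\<close>, the Dirichlet kernel
  \<open>sin (K x) / (2 sin (x/2))\<close> with \<open>K = M + 1/2\<close>. One integration by parts gains the factor \<open>1/K\<close>,
  uniformly away from the jump at \<open>0\<close>; the difference vanishes at \<open>\<pi>\<close>, which fixes the constant of
  integration.\<close>

lemma sawtooth_partial_sum_bound:
  fixes x d :: real
  assumes d: "0 < d" and x: "d \<le> x" "x \<le> pi"
  shows "\<bar>(\<Sum>m<M. sin (real (Suc m) * x) / real (Suc m)) - (pi - x) / 2\<bar>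
           \<le> (pi / (4 * sin (d/2)^2) + 1 / (2 * sin (d/2))) / (real M + 1/2)"
proof -
  define K where "K = real M + 1/2"
  have K: "K > 0" by (simp add: K_def)
  have d': "d \<le> pi" using x by simp
  have sd: "sin (d/2) > 0" using d d' by (intro sin_gt_zero) auto
  have mono: "sin (d/2) \<le> sin (t/2)" if "d \<le> t" "t \<le> pi" for t
    using that d by (intro sin_monotone_2pi_le) auto
  have st: "sin (t/2) > 0" if "d \<le> t" "t \<le> pi" for t using mono[OF that] sd by linarith
  define R where "R t = (\<Sum>m<M. sin (real (Suc m) * t) / real (Suc m)) - (pi - t) / 2" for t
  \<comment> \<open>integration by parts: \<open>G\<close> differs from \<open>R\<close> by the boundary term\<close>
  define G where "G t = R t + cos (K * t) / (2 * K * sin (t/2))" for t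
  define G' where "G' t = - cos (K * t) * cos (t/2) / (4 * K * sin (t/2)^2)" for t
  have R': "(R has_real_derivative sin (K * t) / (2 * sin (t/2))) (at t)" if "d \<le> t" "t \<le> pi" for t
  proof -
    have "(R has_real_derivative ((\<Sum>m<M. cos (real (Suc m) * t)) + 1/2)) (at t)"
      unfolding R_def by (auto intro!: derivative_eq_intros simp del: of_nat_Suc)
    thus ?thesis using dirichlet_kernel_cos[of t M] st[OF that] by (simp add: K_def)
  qed
  have G': "(G has_real_derivative G' t) (at t)" if "d \<le> t" "t \<le> pi" for t
  proof -
    have "((\<lambda>t. cos (K * t) / (2 * K * sin (t/2))) has_real_derivative
            ((- sin (K * t) * K) * (2 * K * sin (t/2)) - cos (K * t) * (2 * K * (cos (t/2) * (1/2)))) / (2 * K * sin (t/2))^2) (at t)"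
      using K st[OF that] by (auto intro!: derivative_eq_intros simp: power2_eq_square)
    from DERIV_add[OF R'[OF that] this]
    show ?thesis unfolding G_def G'_def
      by (rule DERIV_cong) (use K st[OF that] in \<open>simp add: field_simps power2_eq_square\<close>)
  qed
  \<comment> \<open>\<open>K\<close> is a half-integer\<close>
  have "cos (K * pi) = 0"
  proof -
    have "K * pi = real M * pi + pi/2" by (simp add: K_def algebra_simps)
    thus ?thesis by (simp add: cos_add)
  qed
  moreover have "R pi = 0" unfolding R_def by (simp del: of_nat_Suc)
  ultimately have Gpi: "G pi = 0" by (simp add: G_def)
  have bound: "\<bar>G' t\<bar> \<le> 1 / (4 * K * sin (d/2)^2)" if "d \<le> t" "t \<le> pi" for t
  proof -
    have "\<bar>cos (K * t)\<bar> * \<bar>cos (t/2)\<bar> \<le> 1 * 1" by (intro mult_mono) auto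
    moreover have "sin (d/2)^2 \<le> sin (t/2)^2" using mono[OF that] sd by (intro power_mono) auto
    ultimately have "\<bar>cos (K * t)\<bar> * \<bar>cos (t/2)\<bar> / (4 * K * sin (t/2)^2) \<le> 1 / (4 * K * sin (d/2)^2)"
      using K sd st[OF that] by (intro frac_le) auto
    thus ?thesis using K by (simp add: G'_def abs_mult)
  qed
  have "\<bar>G x\<bar> \<le> pi / (4 * K * sin (d/2)^2)"
  proof -
    have "norm (G x - G pi) \<le> 1 / (4 * K * sin (d/2)^2) * norm (x - pi)"
      by (rule field_differentiable_bound[of "{d..pi}" G G'])
         (use x bound G' in \<open>auto intro: has_field_derivative_at_within\<close>)
    also have "\<dots> \<le> 1 / (4 * K * sin (d/2)^2) * pi"
      using x d K by (intro mult_left_mono) auto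
    finally show ?thesis using Gpi by simp
  qed
  moreover have "\<bar>cos (K * x) / (2 * K * sin (x/2))\<bar> \<le> 1 / (2 * K * sin (d/2))"
    using K sd st[OF x] mono[OF x] by (auto simp: abs_mult intro!: frac_le)
  ultimately have "\<bar>R x\<bar> \<le> pi / (4 * K * sin (d/2)^2) + 1 / (2 * K * sin (d/2))"
    unfolding G_def by linarith
  also have "\<dots> = (pi / (4 * sin (d/2)^2) + 1 / (2 * sin (d/2))) / K"
    using K sd by (simp add: field_simps)
  finally show ?thesis by (simp add: R_def K_def)
qed

lemma sawtooth_sums:
  fixes x :: real
  assumes "0 < x" "x \<le> pi"
  shows "(\<lambda>m. sin (real (Suc m) * x) / real (Suc m)) sums ((pi - x) / 2)"
proof -
  define C where "C = pi / (4 * sin (x/2)^2) + 1 / (2 * sin (x/2))"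
  have "(\<lambda>M. C / (real M + 1/2)) \<longlonglongrightarrow> 0" by real_asymp
  hence "(\<lambda>M. (\<Sum>m<M. sin (real (Suc m) * x) / real (Suc m)) - (pi - x) / 2) \<longlonglongrightarrow> 0"
    by (rule Lim_null_comparison[rotated])
       (use sawtooth_partial_sum_bound[of x x] assms in \<open>auto simp: C_def\<close>)
  thus ?thesis unfolding sums_def by (subst (asm) LIM_zero_iff)
qed

text \<open>The threshold \<open>M\<close> depends only on the size of \<open>z\<close>. This uniformity makes the Mittag-Leffler
  series below converge locally uniformly.\<close>

lemma inverse_squares_shift_bound:
  fixes w :: complex
  shows "\<exists>M. \<forall>n\<ge>M. \<forall>z::complex. norm z \<le> norm w \<longrightarrow> norm (of_nat (Suc n)^2 - z) \<ge> real (Suc n)^2 / 2"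
proof -
  obtain M where M: "real M \<ge> 2 * norm w" using real_arch_simple by blast
  show ?thesis
  proof (intro exI[of _ M] allI impI)
    fix n :: nat and z :: complex assume n: "M \<le> n" and z: "norm z \<le> norm w"
    have "2 * norm w \<le> real (Suc n)" using M n by linarith
    also have "\<dots> \<le> real (Suc n)^2" using self_le_power[of "real (Suc n)" 2] by simp
    finally have "norm z \<le> real (Suc n)^2 / 2" using z by simp
    moreover have "norm (of_nat (Suc n)^2 - z) \<ge> real (Suc n)^2 - norm z"
      by (metis norm_of_nat norm_power norm_triangle_ineq2)
    ultimately show "norm (of_nat (Suc n)^2 - z) \<ge> real (Suc n)^2 / 2" by linarith
  qed
qed

lemma summable_inverse_squares: "summable (\<lambda>n. C / real (Suc n)^2)"
  using summable_mult[OF summable_Suc_iff[THEN iffD2, OF inverse_power_summable[of 2, where 'a=real]], of C]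
  by (simp add: field_simps)

lemma square_minus_lower_bound:
  fixes w :: complex
  shows "\<forall>\<^sub>F n in sequentially. norm (of_nat (Suc n)^2 - w) \<ge> real (Suc n)^2 / 2"
  using inverse_squares_shift_bound[of w] by (auto simp: eventually_sequentially)

lemma norm_square_minus_divide_le:
  fixes w c :: complex
  assumes "norm (of_nat (Suc n)^2 - w) \<ge> real (Suc n)^2 / 2" "norm c \<le> C"
  shows "norm (c / (of_nat (Suc n)^2 - w)) \<le> 2 * C / real (Suc n)^2"
proof -
  have "norm (c / (of_nat (Suc n)^2 - w)) = norm c / norm (of_nat (Suc n)^2 - w)"
    by (simp add: norm_divide)
  also have "\<dots> \<le> C / (real (Suc n)^2 / 2)"
    using assms order_trans[OF norm_ge_zero assms(2)] by (intro frac_le) auto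
  finally show ?thesis by (simp add: mult.commute)
qed


lemma
  fixes z :: complex
  shows norm_sin_le_exp_norm: "norm (sin z) \<le> exp (norm z)"
    and norm_cos_le_exp_norm: "norm (cos z) \<le> exp (norm z)"
proof -
  have "norm (exp (\<i> * z)) \<le> exp (norm z)" "norm (exp (- (\<i> * z))) \<le> exp (norm z)"
    using norm_exp[of "\<i> * z"] norm_exp[of "- (\<i> * z)"] by (simp_all only: norm_mult norm_minus_cancel norm_ii mult_1)
  hence "norm (exp (\<i> * z) - exp (- (\<i> * z))) \<le> 2 * exp (norm z)"
    "norm (exp (\<i> * z) + exp (- (\<i> * z))) \<le> 2 * exp (norm z)"
    using norm_triangle_ineq4[of "exp (\<i> * z)" "exp (- (\<i> * z))"]
      norm_triangle_ineq[of "exp (\<i> * z)" "exp (- (\<i> * z))"] by linarith+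
  thus "norm (sin z) \<le> exp (norm z)" "norm (cos z) \<le> exp (norm z)"
    unfolding sin_exp_eq cos_exp_eq by (simp_all add: norm_divide norm_mult)
qed

text \<open>Let \<open>c\<close> and \<open>v\<close> be the two sums as functions of \<open>x\<close>, and \<open>C\<close>, \<open>V\<close> the closed forms. Termwise
  \<open>v' = c\<close> and \<open>c' = - (S + u\<^sup>2 v)\<close>, where \<open>S\<close> is the sawtooth series; \<open>V\<close> and \<open>C\<close> solve the same
  system with \<open>S\<close> replaced by \<open>(\<pi> - x)/2\<close>. Both solutions satisfy the boundary conditions
  \<open>v(0) = v(\<pi>) = 0\<close>, and the homogeneous problem \<open>v'' = - u\<^sup>2 v\<close> with these conditions has only the
  zero solution since \<open>sin (\<pi> u) \<noteq> 0\<close>.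

  Because \<open>S\<close> converges only conditionally, and not uniformly near \<open>0\<close>, the argument is run on partial
  sums: the combinations \<open>A\<close> and \<open>B\<close> below are first integrals of the homogeneous system, their
  derivatives are the sawtooth errors \<open>\<rho>\<close> times bounded functions, and in the limit they become constant
  on \<open>(0, \<pi>]\<close>, hence on \<open>[0, \<pi>]\<close> by continuity.\<close>

lemma twisted_partial_fractions:
  fixes u :: complex and x :: real
  assumes u: "sin (of_real pi * u) \<noteq> 0" and x: "0 \<le> x" "x \<le> pi"
  defines "w \<equiv> sin (of_real pi * u)"
  shows "(\<lambda>m. cos (of_nat (Suc m) * of_real x) / (of_nat (Suc m)^2 - u^2)) sums
           (1 / (2 * u^2) - of_real pi * cos (u * (of_real pi - of_real x)) / (2 * u * w))" (is ?th1)
    and "(\<lambda>m. sin (of_nat (Suc m) * of_real x) / (of_nat (Suc m) * (of_nat (Suc m)^2 - u^2))) sums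
           ((of_real x - of_real pi) / (2 * u^2) + of_real pi * sin (u * (of_real pi - of_real x)) / (2 * u^2 * w))" (is ?th2)
proof -
  have u0: "u \<noteq> 0" and w0: "w \<noteq> 0" using u by (auto simp: w_def)
  have un: "of_nat (Suc m)^2 - u^2 \<noteq> 0" for m
  proof
    assume "of_nat (Suc m)^2 - u^2 = 0"
    hence "u^2 = of_nat (Suc m)^2" by simp
    hence "u = of_nat (Suc m) \<or> u = - of_nat (Suc m)" unfolding power2_eq_iff .
    hence "sin (of_real pi * u) = 0"
    proof
      assume "u = of_nat (Suc m)"
      hence "of_real pi * u = of_real (real (Suc m) * pi)" by (simp del: of_nat_Suc)
      thus ?thesis by (simp only: sin_of_real sin_npi) simp
    next
      assume "u = - of_nat (Suc m)"
      hence "of_real pi * u = - of_real (real (Suc m) * pi)" by (simp del: of_nat_Suc)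
      thus ?thesis by (simp only: sin_minus sin_of_real sin_npi) simp
    qed
    with u show False by simp
  qed
  define c where "c m z = cos (of_nat (Suc m) * z) / (of_nat (Suc m)^2 - u^2)" for m :: nat and z :: complex
  define v where "v m z = sin (of_nat (Suc m) * z) / (of_nat (Suc m) * (of_nat (Suc m)^2 - u^2))" for m :: nat and z :: complex
  define s where "s m z = sin (of_nat (Suc m) * z) / of_nat (Suc m)" for m :: nat and z :: complex
  define C where "C z = 1 / (2 * u^2) - of_real pi * cos (u * (of_real pi - z)) / (2 * u * w)" for z
  define V where "V z = (z - of_real pi) / (2 * u^2) + of_real pi * sin (u * (of_real pi - z)) / (2 * u^2 * w)" for z
  define cM where "cM M z = (\<Sum>m<M. c m z) - C z" for M z
  define vM where "vM M z = (\<Sum>m<M. v m z) - V z" for M z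
  define rho where "rho M z = (\<Sum>m<M. s m z) - (of_real pi - z) / 2" for M z
  have dv: "(v m has_field_derivative c m z) (at z)" for m z
  proof -
    define n :: complex where "n = of_nat (Suc m)"
    have n: "n \<noteq> 0" using of_nat_neq_0 unfolding n_def by blast
    have "((\<lambda>z. sin (n * z)) has_field_derivative cos (n * z) * n) (at z)"
      by (auto intro!: derivative_eq_intros)
    from DERIV_cdivide[OF this, of "n * (n^2 - u^2)"] show ?thesis
      unfolding v_def c_def n_def[symmetric] using n by simp
  qed
  have dc: "(c m has_field_derivative - (s m z + u^2 * v m z)) (at z)" for m z
  proof -
    define n :: complex where "n = of_nat (Suc m)"
    have n: "n \<noteq> 0" "n^2 - u^2 \<noteq> 0" using un[of m] by (auto simp: n_def simp del: of_nat_Suc)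
    have "(c m has_field_derivative - sin (n * z) * n / (n^2 - u^2)) (at z)"
      unfolding c_def n_def[symmetric] using n by (auto intro!: derivative_eq_intros)
    moreover have "- sin (n * z) * n / (n^2 - u^2) = - (s m z + u^2 * v m z)"
      unfolding s_def v_def n_def[symmetric] using n by (simp add: divide_simps power2_eq_square) (simp add: algebra_simps)
    ultimately show ?thesis by simp
  qed
  have dV: "(V has_field_derivative C z) (at z)" for z
    unfolding V_def C_def using u0 w0
    by (auto intro!: derivative_eq_intros simp: field_simps power2_eq_square)
  have dC: "(C has_field_derivative - ((of_real pi - z) / 2 + u^2 * V z)) (at z)" for z
    unfolding V_def C_def using u0 w0
    by (auto intro!: derivative_eq_intros simp: field_simps power2_eq_square)
  have dvM: "(vM M has_field_derivative cM M z) (at z)" for M z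
    unfolding vM_def cM_def by (intro DERIV_diff DERIV_sum dv dV)
  have dcM: "(cM M has_field_derivative - (rho M z + u^2 * vM M z)) (at z)" for M z
  proof -
    have "(cM M has_field_derivative (\<Sum>m<M. - (s m z + u^2 * v m z)) - (- ((of_real pi - z) / 2 + u^2 * V z))) (at z)"
      unfolding cM_def by (intro DERIV_diff DERIV_sum dc dC)
    thus ?thesis
      by (rule DERIV_cong) (simp add: rho_def vM_def sum_negf sum.distrib sum_subtractf sum_distrib_left right_diff_distrib
           del: minus_add_distrib)
  qed
  \<comment> \<open>the conserved quantities of \<open>v' = c\<close>, \<open>c' = - u\<^sup>2 v\<close>\<close>
  define A where "A M z = u * vM M z * cos (u * z) - cM M z * sin (u * z)" for M z
  define B where "B M z = u * vM M z * sin (u * z) + cM M z * cos (u * z)" for M z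
  have dA: "(A M has_field_derivative rho M z * sin (u * z)) (at z)" for M z
    unfolding A_def by (auto intro!: derivative_eq_intros dvM dcM simp: algebra_simps power2_eq_square)
  have dB: "(B M has_field_derivative - rho M z * cos (u * z)) (at z)" for M z
    unfolding B_def by (auto intro!: derivative_eq_intros dvM dcM simp: algebra_simps power2_eq_square)

  obtain K where K: "\<And>n. n \<ge> K \<Longrightarrow> norm (of_nat (Suc n)^2 - u^2) \<ge> real (Suc n)^2 / 2"
    using square_minus_lower_bound[of "u^2"] by (auto simp: eventually_sequentially)
  have cs_le: "norm (cos (of_nat n * of_real t :: complex)) \<le> 1" "norm (sin (of_nat n * of_real t :: complex)) \<le> 1" for n t
  proof -
    have "of_nat n * of_real t = (of_real (real n * t) :: complex)" by simp
    thus "norm (cos (of_nat n * of_real t :: complex)) \<le> 1" "norm (sin (of_nat n * of_real t :: complex)) \<le> 1"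
      by (simp_all only: cos_of_real sin_of_real norm_of_real abs_cos_le_one abs_sin_le_one)
  qed
  have cb: "norm (c n (of_real t)) \<le> 2 / real (Suc n)^2" if "n \<ge> K" for n t
    using norm_square_minus_divide_le[OF K[OF that] cs_le(1)[of "Suc n" t]] by (simp add: c_def)
  have vb: "norm (v n (of_real t)) \<le> 2 / real (Suc n)^2" if "n \<ge> K" for n t
  proof -
    have "norm (s n (of_real t)) \<le> 1 / 1"
      unfolding s_def norm_divide by (rule frac_le) (use cs_le(2)[of "Suc n" t] in \<open>auto simp del: of_nat_Suc simp: norm_of_nat\<close>)
    from norm_square_minus_divide_le[OF K[OF that] this] show ?thesis by (simp add: v_def s_def)
  qed
  have "uniformly_convergent_on UNIV (\<lambda>M t::real. \<Sum>m<M. c m (of_real t))"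
    by (rule Weierstrass_m_test'_ev[OF _ summable_inverse_squares[of 2]])
       (use cb in \<open>auto simp: eventually_sequentially\<close>)
  then obtain c' where c': "uniform_limit UNIV (\<lambda>M t::real. \<Sum>m<M. c m (of_real t)) c' sequentially"
    by (auto simp: uniformly_convergent_on_def)
  have "uniformly_convergent_on UNIV (\<lambda>M t::real. \<Sum>m<M. v m (of_real t))"
    by (rule Weierstrass_m_test'_ev[OF _ summable_inverse_squares[of 2]])
       (use vb in \<open>auto simp: eventually_sequentially\<close>)
  then obtain v' where v': "uniform_limit UNIV (\<lambda>M t::real. \<Sum>m<M. v m (of_real t)) v' sequentially"
    by (auto simp: uniformly_convergent_on_def)
  have cont: "continuous_on UNIV c'" "continuous_on UNIV v'"
  proof -
    have "continuous_on UNIV (\<lambda>t::real. \<Sum>m<M. c m (of_real t))" for M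
      unfolding c_def using un by (intro continuous_intros) auto
    from uniform_limit_theorem[OF always_eventually c'] this show "continuous_on UNIV c'" by auto
    have "continuous_on UNIV (\<lambda>t::real. \<Sum>m<M. v m (of_real t))" for M
      unfolding v_def using un by (intro continuous_intros) (auto simp del: of_nat_Suc)
    from uniform_limit_theorem[OF always_eventually v'] this show "continuous_on UNIV v'" by auto
  qed
  have lim: "(\<lambda>M. \<Sum>m<M. c m (of_real t)) \<longlonglongrightarrow> c' t" "(\<lambda>M. \<Sum>m<M. v m (of_real t)) \<longlonglongrightarrow> v' t" for t
    using tendsto_uniform_limitI[OF c'] tendsto_uniform_limitI[OF v'] by auto
  define A' where "A' t = u * (v' t - V (of_real t)) * cos (u * of_real t) - (c' t - C (of_real t)) * sin (u * of_real t)" for t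
  define B' where "B' t = u * (v' t - V (of_real t)) * sin (u * of_real t) + (c' t - C (of_real t)) * cos (u * of_real t)" for t
  have limA: "(\<lambda>M. A M (of_real t)) \<longlonglongrightarrow> A' t" for t
    unfolding A_def A'_def cM_def vM_def by (intro tendsto_intros lim)
  have limB: "(\<lambda>M. B M (of_real t)) \<longlonglongrightarrow> B' t" for t
    unfolding B_def B'_def cM_def vM_def by (intro tendsto_intros lim)
  have contAB: "continuous_on {0..pi} A'" "continuous_on {0..pi} B'"
    unfolding A'_def B'_def V_def C_def using u0 w0
    by (auto intro!: continuous_intros continuous_on_subset[OF cont(1)] continuous_on_subset[OF cont(2)])
  have const: "A' t = A' pi \<and> B' t = B' pi" if t: "0 < t" "t \<le> pi" for t
  proof -
    define D where "D = pi / (4 * sin (t/2)^2) + 1 / (2 * sin (t/2))"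
    have D: "norm (rho M (of_real y)) \<le> D / (real M + 1/2)" if "t \<le> y" "y \<le> pi" for y M
    proof -
      have "rho M (of_real y) = of_real ((\<Sum>m<M. sin (real (Suc m) * y) / real (Suc m)) - (pi - y) / 2)"
      proof -
        have "s m (of_real y) = of_real (sin (real (Suc m) * y) / real (Suc m))" for m
        proof -
          have "of_nat (Suc m) * of_real y = (of_real (real (Suc m) * y) :: complex)" by simp
          thus ?thesis unfolding s_def by (simp only: sin_of_real of_real_divide of_real_of_nat_eq)
        qed
        thus ?thesis by (simp add: rho_def)
      qed
      thus ?thesis using sawtooth_partial_sum_bound[OF t(1) that, of M] unfolding D_def by (simp only: norm_of_real)
    qed
    define E where "E = exp (norm u * pi)"
    have cs: "norm (sin (u * of_real y)) \<le> E" "norm (cos (u * of_real y)) \<le> E" if "t \<le> y" "y \<le> pi" for y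
    proof -
      have "exp (norm (u * of_real y)) \<le> E" unfolding E_def using that t
        by (auto simp: norm_mult intro!: mult_left_mono)
      thus "norm (sin (u * of_real y)) \<le> E" "norm (cos (u * of_real y)) \<le> E"
        using norm_sin_le_exp_norm[of "u * of_real y"] norm_cos_le_exp_norm[of "u * of_real y"] by simp_all
    qed
    have convex: "convex (complex_of_real ` {t..pi})"
      by (intro convex_linear_image) (auto intro: bounded_linear.linear bounded_linear_of_real)
    have E: "E > 0" by (simp add: E_def)
    have "norm (A M (of_real t) - A M (of_real pi)) \<le> D / (real M + 1/2) * E * norm (of_real t - of_real pi :: complex)" for M
    proof (rule field_differentiable_bound[OF convex has_field_derivative_at_within[OF dA]])
      fix z :: complex assume "z \<in> of_real ` {t..pi}"
      then obtain y where y: "z = of_real y" "t \<le> y" "y \<le> pi" by auto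
      show "norm (rho M z * sin (u * z)) \<le> D / (real M + 1/2) * E"
        unfolding norm_mult y(1) by (intro mult_mono D cs y) (use order_trans[OF norm_ge_zero D[OF y(2,3)]] in auto)
    qed (use t in auto)
    moreover have "(\<lambda>M. D / (real M + 1/2) * E * norm (of_real t - of_real pi :: complex)) \<longlonglongrightarrow> 0"
      by real_asymp
    ultimately have "(\<lambda>M. A M (of_real t) - A M (of_real pi)) \<longlonglongrightarrow> 0"
      by (rule Lim_null_comparison[OF always_eventually[OF allI]])
    hence 1: "A' t - A' pi = 0" using LIMSEQ_unique tendsto_diff[OF limA limA] by blast
    have "norm (B M (of_real t) - B M (of_real pi)) \<le> D / (real M + 1/2) * E * norm (of_real t - of_real pi :: complex)" for M
    proof (rule field_differentiable_bound[OF convex has_field_derivative_at_within[OF dB]])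
      fix z :: complex assume "z \<in> of_real ` {t..pi}"
      then obtain y where y: "z = of_real y" "t \<le> y" "y \<le> pi" by auto
      show "norm (- rho M z * cos (u * z)) \<le> D / (real M + 1/2) * E"
        unfolding norm_mult norm_minus_cancel y(1) by (intro mult_mono D cs y) (use order_trans[OF norm_ge_zero D[OF y(2,3)]] in auto)
    qed (use t in auto)
    moreover have "(\<lambda>M. D / (real M + 1/2) * E * norm (of_real t - of_real pi :: complex)) \<longlonglongrightarrow> 0"
      by real_asymp
    ultimately have "(\<lambda>M. B M (of_real t) - B M (of_real pi)) \<longlonglongrightarrow> 0"
      by (rule Lim_null_comparison[OF always_eventually[OF allI]])
    hence "B' t - B' pi = 0" using LIMSEQ_unique tendsto_diff[OF limB limB] by blast
    with 1 show ?thesis by simp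
  qed
  have at0: "A' 0 = A' pi"
  proof -
    have "((\<lambda>t. A' t) \<longlongrightarrow> A' 0) (at_right 0)"
      using contAB(1) by (simp add: continuous_on_Icc_at_rightD)
    moreover have "((\<lambda>t. A' t) \<longlongrightarrow> A' pi) (at_right 0)"
    proof (intro tendsto_eventually eventually_mono[OF eventually_at_right_real[OF pi_gt_zero]])
      show "A' t = A' pi" if "t \<in> {0<..<pi}" for t using const[of t] that by simp
    qed
    ultimately show ?thesis using tendsto_unique trivial_limit_at_right_real by blast
  qed
  have at0B: "B' 0 = B' pi"
  proof -
    have "((\<lambda>t. B' t) \<longlongrightarrow> B' 0) (at_right 0)"
      using contAB(2) by (simp add: continuous_on_Icc_at_rightD)
    moreover have "((\<lambda>t. B' t) \<longlongrightarrow> B' pi) (at_right 0)"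
    proof (intro tendsto_eventually eventually_mono[OF eventually_at_right_real[OF pi_gt_zero]])
      show "B' t = B' pi" if "t \<in> {0<..<pi}" for t using const[of t] that by simp
    qed
    ultimately show ?thesis using tendsto_unique trivial_limit_at_right_real by blast
  qed
  have v'0: "v' 0 = 0" using LIMSEQ_unique[OF lim(2)[of 0]] by (simp add: v_def)
  have v'pi: "v' pi = 0"
  proof -
    have "v m (of_real pi) = 0" for m
    proof -
      have "of_nat (Suc m) * of_real pi = (of_real (real (Suc m) * pi) :: complex)" by simp
      thus ?thesis unfolding v_def by (simp only: sin_of_real sin_npi) simp
    qed
    thus ?thesis using LIMSEQ_unique[OF lim(2)[of pi]] by simp
  qed
  have V0: "V 0 = 0" "V (of_real pi) = 0"
    unfolding V_def using u0 w0 by (auto simp: w_def mult.commute field_simps)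
  have "A' 0 = 0" by (simp add: A'_def v'0 V0)
  hence "A' pi = 0" using at0 by simp
  hence "c' pi = C (of_real pi)" using w0 by (simp add: A'_def v'pi V0 w_def mult.commute)
  hence "B' pi = 0" by (simp add: B'_def v'pi V0)
  hence AB: "A' x = 0" "B' x = 0" using const[of x] at0 at0B \<open>A' pi = 0\<close> x by (cases "x = 0"; simp)+
  \<comment> \<open>inverting the rotation that defines \<open>A'\<close> and \<open>B'\<close>\<close>
  have sc: "sin (u * of_real x)^2 + cos (u * of_real x)^2 = 1" by simp
  have "u * (v' x - V (of_real x)) * (sin (u * of_real x)^2 + cos (u * of_real x)^2)
          = A' x * cos (u * of_real x) + B' x * sin (u * of_real x)"
    unfolding A'_def B'_def by (simp only: algebra_simps power2_eq_square)
  hence 1: "v' x = V (of_real x)" unfolding sc AB using u0 by simp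
  have "(c' x - C (of_real x)) * (sin (u * of_real x)^2 + cos (u * of_real x)^2)
          = B' x * cos (u * of_real x) - A' x * sin (u * of_real x)"
    unfolding A'_def B'_def by (simp only: algebra_simps power2_eq_square)
  hence 2: "c' x = C (of_real x)" unfolding sc AB by simp
  show ?th1 using lim(1)[of x] unfolding sums_def 2 c_def C_def .
  show ?th2 using lim(2)[of x] unfolding sums_def 1 v_def V_def .
qed

section \<open>Mittag-Leffler series and their Taylor coefficients\<close>

text \<open>The Mittag-Leffler series \<open>\<Sum>n. n\<^sup>2 p\<^sub>n / (n\<^sup>2 - w)\<close>, with the terms at \<open>w = 0\<close> split off so that it
  makes sense when \<open>\<Sum>n. p\<^sub>n\<close> converges only conditionally. The summation index is shifted, \<open>n = m + 1\<close>.\<close>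

definition borel_kernel :: "(nat \<Rightarrow> complex) \<Rightarrow> complex \<Rightarrow> complex" where
  "borel_kernel p w = (\<Sum>m. p m) + w * (\<Sum>m. p m / (of_nat (Suc m)^2 - w))"

definition slit_plane :: "complex set" where
  "slit_plane = {w. \<not> (Im w = 0 \<and> Re w \<ge> 1)}"

lemma open_slit_plane: "open slit_plane"
proof -
  have "closed ({w. Im w = 0} \<inter> {w. Re w \<ge> 1})"
    by (intro closed_Int closed_Collect_eq closed_Collect_le continuous_intros)
  hence "open (- ({w. Im w = 0} \<inter> {w. Re w \<ge> 1}))" by (rule open_Compl)
  also have "- ({w. Im w = 0} \<inter> {w. Re w \<ge> 1}) = slit_plane"
    by (auto simp: slit_plane_def)
  finally show ?thesis .
qed

lemma slit_plane_square_neq: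
  assumes "w \<in> slit_plane" shows "of_nat (Suc m)^2 - w \<noteq> 0"
proof
  assume "of_nat (Suc m)^2 - w = 0"
  hence "w = of_real (real (Suc m)^2)" by simp
  moreover have "real (Suc m)^2 \<ge> 1" by (rule one_le_power) simp
  ultimately show False using assms by (simp add: slit_plane_def del: of_nat_Suc of_real_power)
qed

lemma summable_borel_kernel:
  fixes p :: "nat \<Rightarrow> complex"
  assumes "\<And>m. norm (p m) \<le> 1"
  shows "summable (\<lambda>m. p m / (of_nat (Suc m)^2 - w))"
proof (rule summable_comparison_test_ev)
  show "\<forall>\<^sub>F m in sequentially. norm (p m / (of_nat (Suc m)^2 - w)) \<le> 2 / real (Suc m)^2"
    using square_minus_lower_bound[of w]
    by eventually_elim (use norm_square_minus_divide_le[OF _ assms] in auto)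
qed (rule summable_inverse_squares)

lemma holomorphic_borel_kernel:
  fixes p :: "nat \<Rightarrow> complex"
  assumes p: "\<And>m. norm (p m) \<le> 1"
  shows "borel_kernel p holomorphic_on slit_plane"
proof -
  have "(\<lambda>w. \<Sum>m. p m / (of_nat (Suc m)^2 - w)) holomorphic_on slit_plane"
  proof (rule holomorphic_uniform_sequence[OF open_slit_plane])
    show "(\<lambda>w. \<Sum>m<M. p m / (of_nat (Suc m)^2 - w)) holomorphic_on slit_plane" for M
      using slit_plane_square_neq by (intro holomorphic_intros) blast
    fix x assume "x \<in> slit_plane"
    then obtain d where d: "d > 0" "cball x d \<subseteq> slit_plane"
      using open_slit_plane open_contains_cball by blast
    obtain K where K: "\<forall>n\<ge>K. \<forall>z::complex. norm z \<le> norm (of_real (norm x + d) :: complex) \<longrightarrow>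
         norm (of_nat (Suc n)^2 - z) \<ge> real (Suc n)^2 / 2"
      using inverse_squares_shift_bound[of "of_real (norm x + d)"] by blast
    have "norm z \<le> norm (of_real (norm x + d) :: complex)" if "z \<in> cball x d" for z
      using that norm_triangle_ineq2[of z x] d
      by (simp add: dist_norm norm_minus_commute del: of_real_add)
    hence "uniform_limit (cball x d) (\<lambda>M w. \<Sum>m<M. p m / (of_nat (Suc m)^2 - w))
            (\<lambda>w. \<Sum>m. p m / (of_nat (Suc m)^2 - w)) sequentially"
      using K by (intro Weierstrass_m_test_ev[OF _ summable_inverse_squares[of 2]] eventually_sequentiallyI[of K] ballI)
        (use norm_square_minus_divide_le[OF _ p] in auto)
    thus "\<exists>d. 0 < d \<and> cball x d \<subseteq> slit_plane \<and> uniform_limit (cball x d)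
            (\<lambda>M w. \<Sum>m<M. p m / (of_nat (Suc m)^2 - w)) (\<lambda>w. \<Sum>m. p m / (of_nat (Suc m)^2 - w)) sequentially"
      using d by blast
  qed
  thus ?thesis unfolding borel_kernel_def by (intro holomorphic_intros)
qed

text \<open>Repeated use of \<open>1 / (n\<^sup>2 - w) = 1 / n\<^sup>2 + (w / n\<^sup>2) / (n\<^sup>2 - w)\<close> peels off one Taylor coefficient at a
  time and leaves a remainder \<open>w\<^sup>L\<^sup>+\<^sup>1 Q\<^sub>L\<close> with bounded \<open>Q\<^sub>L\<close>. This avoids an interchange of the two
  summations, which is delicate when \<open>\<Sum>n. p\<^sub>n\<close> converges only conditionally.\<close>

lemma borel_kernel_power_series:
  fixes p :: "nat \<Rightarrow> complex"
  assumes p: "\<And>m. norm (p m) \<le> 1" and sp: "summable p" and w: "norm w < 1/2"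
  shows "(\<lambda>l. (\<Sum>m. p m / of_nat (Suc m)^(2*l)) * w^l) sums borel_kernel p w"
proof -
  define c where "c l = (\<Sum>m. p m / of_nat (Suc m)^(2*l))" for l
  define Q where "Q L = (\<Sum>m. p m / of_nat (Suc m)^(2*L) / (of_nat (Suc m)^2 - w))" for L
  have lower: "norm (of_nat (Suc m)^2 - w) \<ge> real (Suc m)^2 / 2" for m
  proof -
    have "real (Suc m)^2 \<ge> 1" by (rule one_le_power) simp
    moreover have "norm (of_nat (Suc m)^2 - w) \<ge> real (Suc m)^2 - norm w"
      by (metis norm_of_nat norm_power norm_triangle_ineq2)
    ultimately show ?thesis using w by linarith
  qed
  have nz: "of_nat (Suc m)^2 - w \<noteq> 0" for m
    using lower[of m] by (metis norm_zero not_le half_gt_zero of_nat_0_less_iff zero_less_Suc zero_less_power)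
  have pl: "norm (p m / of_nat (Suc m)^(2*L)) \<le> 1" for m L
  proof -
    have "norm (p m / of_nat (Suc m)^(2*L)) = norm (p m) / real (Suc m)^(2*L)"
      by (simp only: norm_divide norm_power norm_of_nat)
    also have "\<dots> \<le> 1 / 1" using p by (intro frac_le one_le_power) auto
    finally show ?thesis by simp
  qed
  have Qle: "norm (p m / of_nat (Suc m)^(2*L) / (of_nat (Suc m)^2 - w)) \<le> 2 / real (Suc m)^2" for m L
    using norm_square_minus_divide_le[OF lower pl] by simp
  have sQ: "summable (\<lambda>m. p m / of_nat (Suc m)^(2*L) / (of_nat (Suc m)^2 - w))" for L
    using summable_comparison_test'[OF summable_inverse_squares Qle] .
  have nQ: "norm (Q L) \<le> (\<Sum>m. 2 / real (Suc m)^2)" for L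
    unfolding Q_def
    by (rule order_trans[OF summable_norm suminf_le[OF Qle]])
       (use summable_comparison_test'[OF summable_inverse_squares, of 0 "\<lambda>m. norm (p m / of_nat (Suc m)^(2*L) / (of_nat (Suc m)^2 - w))"] Qle summable_inverse_squares[of 2] in auto)
  have sc: "summable (\<lambda>m. p m / of_nat (Suc m)^(2 * Suc L))" for L
  proof (rule summable_comparison_test'[OF summable_inverse_squares[of 1], of 0])
    fix m
    have "norm (p m / of_nat (Suc m)^(2 * Suc L)) = norm (p m / of_nat (Suc m)^(2*L)) / real (Suc m)^2"
      by (simp add: norm_divide norm_power power2_eq_square norm_mult del: of_nat_Suc)
    also have "\<dots> \<le> 1 / real (Suc m)^2" by (intro divide_right_mono pl) auto
    finally show "norm (p m / of_nat (Suc m)^(2 * Suc L)) \<le> 1 / real (Suc m)^2" .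
  qed
  have Qrec: "Q L = c (Suc L) + w * Q (Suc L)" for L
  proof -
    have "Q L = (\<Sum>m. p m / of_nat (Suc m)^(2 * Suc L) + w * (p m / of_nat (Suc m)^(2 * Suc L) / (of_nat (Suc m)^2 - w)))"
      unfolding Q_def
    proof (intro suminf_cong)
      fix m
      define n :: complex where "n = of_nat (Suc m)"
      have n: "n \<noteq> 0" "n^2 - w \<noteq> 0" using of_nat_neq_0 nz[of m] unfolding n_def by blast+
      have pw: "n^(2 * Suc L) = n^(2*L) * n^2" by (simp add: power2_eq_square)
      show "p m / of_nat (Suc m)^(2*L) / (of_nat (Suc m)^2 - w) =
        p m / of_nat (Suc m)^(2 * Suc L) + w * (p m / of_nat (Suc m)^(2 * Suc L) / (of_nat (Suc m)^2 - w))"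
        unfolding n_def[symmetric] pw using n by (simp add: divide_simps) (simp add: algebra_simps)
    qed
    also have "\<dots> = c (Suc L) + w * Q (Suc L)"
      unfolding c_def Q_def
      by (subst suminf_add[OF sc summable_mult[OF sQ], symmetric]) (simp only: suminf_mult[OF sQ])
    finally show ?thesis .
  qed
  have "borel_kernel p w = (\<Sum>l\<le>L. c l * w^l) + w^Suc L * Q L" for L
  proof (induction L)
    case 0
    show ?case by (simp add: borel_kernel_def c_def Q_def)
  next
    case (Suc L)
    show ?case unfolding Suc Qrec[of L] by (simp add: algebra_simps)
  qed
  hence eq: "(\<Sum>l\<le>L. c l * w^l) - borel_kernel p w = - (w^Suc L * Q L)" for L by (metis add_diff_cancel_left' minus_diff_eq)
  have "(\<lambda>L. (\<Sum>l\<le>L. c l * w^l) - borel_kernel p w) \<longlonglongrightarrow> 0"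
  proof (rule Lim_null_comparison[OF always_eventually[OF allI]])
    show "norm ((\<Sum>l\<le>L. c l * w^l) - borel_kernel p w) \<le> norm w ^ Suc L * (\<Sum>m. 2 / real (Suc m)^2)" for L
      unfolding eq norm_minus_cancel norm_mult norm_power by (intro mult_left_mono nQ) auto
    have "(\<lambda>L. norm w ^ Suc L) \<longlonglongrightarrow> 0" using w by (intro LIMSEQ_Suc LIMSEQ_realpow_zero) auto
    thus "(\<lambda>L. norm w ^ Suc L * (\<Sum>m. 2 / real (Suc m)^2)) \<longlonglongrightarrow> 0" by (rule tendsto_mult_left_zero)
  qed
  hence "(\<lambda>L. \<Sum>l\<le>L. c l * w^l) \<longlonglongrightarrow> borel_kernel p w" by (subst (asm) LIM_zero_iff)
  thus ?thesis unfolding sums_def_le c_def .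
qed

text \<open>The poles lie on the ray where \<open>b \<xi> \<ge> 1\<close> is real, so the complement of this ray is a star domain
  to which the power series continues.\<close>

lemma continues_on_borel_kernel:
  fixes p :: "nat \<Rightarrow> complex"
  assumes p: "\<And>m. norm (p m) \<le> 1" and sp: "summable p"
    and F: "\<And>l. fps_nth F l = K * b^l * (\<Sum>m. p m / of_nat (Suc m)^(2*l))"
  shows "continues_on F {\<xi>. b * \<xi> \<in> slit_plane} (\<lambda>\<xi>. K * borel_kernel p (b * \<xi>))"
  unfolding continues_on_def
proof (intro conjI ballI)
  have cont: "continuous_on UNIV (\<lambda>\<xi>. b * \<xi>)" by (intro continuous_intros)
  have vimage: "{\<xi>. b * \<xi> \<in> slit_plane} = (\<lambda>\<xi>. b * \<xi>) -` slit_plane" by auto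
  show "open {\<xi>. b * \<xi> \<in> slit_plane}"
    unfolding vimage by (rule open_vimage[OF open_slit_plane cont])
  show "0 \<in> {\<xi>. b * \<xi> \<in> slit_plane}" by (simp add: slit_plane_def)
  show "closed_segment 0 z \<subseteq> {\<xi>. b * \<xi> \<in> slit_plane}" if z: "z \<in> {\<xi>. b * \<xi> \<in> slit_plane}" for z
  proof
    fix y assume "y \<in> closed_segment 0 z"
    then obtain t where t: "0 \<le> t" "t \<le> 1" "y = of_real t * z" by (auto simp: in_segment scaleR_conv_of_real)
    have bz: "b * y = of_real t * (b * z)" using t by simp
    have parts: "Im (b * y) = t * Im (b * z)" "Re (b * y) = t * Re (b * z)"
      unfolding bz by (simp_all only: Re_complex_of_real Im_complex_of_real times_complex.sel mult_zero_left add_0_right diff_0_right)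
    show "y \<in> {\<xi>. b * \<xi> \<in> slit_plane}"
    proof (rule ccontr)
      assume "y \<notin> {\<xi>. b * \<xi> \<in> slit_plane}"
      hence "Im (b * y) = 0" "Re (b * y) \<ge> 1" unfolding slit_plane_def by blast+
      hence y: "t * Im (b * z) = 0" "t * Re (b * z) \<ge> 1" unfolding parts by blast+
      hence "t > 0" using t by (cases "t = 0") auto
      hence "Re (b * z) > 0" using y(2) by (metis less_le_trans zero_less_mult_pos zero_less_one)
      hence "t * Re (b * z) \<le> 1 * Re (b * z)" using t by (intro mult_right_mono) auto
      hence "Re (b * z) \<ge> 1" "Im (b * z) = 0" using y \<open>t > 0\<close> by (auto simp del: times_complex.sel)
      with z show False unfolding slit_plane_def by blast
    qed
  qed
  have "borel_kernel p \<circ> (\<lambda>\<xi>. b * \<xi>) holomorphic_on {\<xi>. b * \<xi> \<in> slit_plane}"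
    by (rule holomorphic_on_compose_gen[OF _ holomorphic_borel_kernel[OF p]]) (auto intro!: holomorphic_intros)
  thus "(\<lambda>\<xi>. K * borel_kernel p (b * \<xi>)) holomorphic_on {\<xi>. b * \<xi> \<in> slit_plane}"
    by (auto simp: o_def intro!: holomorphic_intros)
  have "((\<lambda>\<xi>. norm (b * \<xi>)) \<longlongrightarrow> norm (b * 0)) (nhds 0)" by (intro tendsto_intros filterlim_ident)
  hence "\<forall>\<^sub>F \<xi> in nhds 0. norm (b * \<xi>) < 1/2" by (rule order_tendstoD) simp
  hence "\<forall>\<^sub>F \<xi> in nhds 0. (\<lambda>l. fps_nth F l * \<xi>^l) sums (K * borel_kernel p (b * \<xi>))"
  proof eventually_elim
    case (elim \<xi>)
    from sums_mult[OF borel_kernel_power_series[OF p sp elim], of K] show ?case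
      by (simp add: F power_mult_distrib mult_ac)
  qed
  thus "(\<lambda>\<xi>. K * borel_kernel p (b * \<xi>)) has_fps_expansion F" by (rule has_fps_expansionI)
qed

section \<open>Gaussian integrals along bent lines\<close>

lemma set_integrable_exp_minus: "set_integrable lborel {0..} (\<lambda>s::real. exp (- s))"
proof -
  have "(\<lambda>s::real. exp (- 1 * s)) absolutely_integrable_on {0..}"
    by (intro nonnegative_absolutely_integrable_1 integrable_on_exp_minus_to_infinity) auto
  thus ?thesis
    unfolding set_integrable_def by (subst (asm) integrable_completion) auto
qed

lemma set_integrable_gaussian_bound:
  fixes f :: "real \<Rightarrow> complex"
  assumes f: "continuous_on {0..} f" and a: "a > 0"
    and le: "\<And>s. s \<ge> 0 \<Longrightarrow> norm (f s) \<le> C * exp (b * s - a * s^2)"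
  shows "set_integrable lborel {0..} f"
proof -
  define D where "D = (b + 1)^2 / (4 * a)"
  have C: "C \<ge> 0" using order_trans[OF norm_ge_zero le[of 0]] by simp
  \<comment> \<open>completing the square turns the Gaussian bound into the bound \<open>exp (- s)\<close>\<close>
  have exponent: "b * s - a * s^2 \<le> D - s" for s
  proof -
    have "D - s - (b * s - a * s^2) = a * (s - (b + 1) / (2 * a))^2"
      using a by (simp add: D_def power2_eq_square field_simps)
    also have "\<dots> \<ge> 0" using a by simp
    finally show ?thesis by linarith
  qed
  have "set_integrable lborel {0..} (\<lambda>s. C * exp D * exp (- s))"
    by (intro set_integrable_mult_right set_integrable_exp_minus)
  thus ?thesis
  proof (rule set_integrable_bound)
    show "set_borel_measurable lborel {0..} f"
      unfolding set_borel_measurable_def using borel_measurable_continuous_on_indicator[OF _ f] by simp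
    have "norm (f s) \<le> norm (C * exp D * exp (- s))" if "s \<ge> 0" for s
    proof -
      have "norm (f s) \<le> C * exp (b * s - a * s^2)" by (rule le[OF that])
      also have "\<dots> \<le> C * exp (D - s)" using C exponent by (intro mult_left_mono) auto
      finally show ?thesis using C by (simp add: exp_diff exp_minus divide_inverse)
    qed
    thus "AE x\<in>{0..} in lborel. norm (f x) \<le> norm (C * exp D * exp (- x))" by auto
  qed
qed

text \<open>Stated as a limit, not for a given value of \<open>F\<close> at infinity: for the real Gaussian it is the
  integral that is known, and the limit of the primitive is read off from it.\<close>

lemma tendsto_integral_FTC_atLeast:
  fixes f F :: "real \<Rightarrow> complex"
  assumes f: "continuous_on {0..} f" "set_integrable lborel {0..} f"
    and F: "\<And>s. s \<ge> 0 \<Longrightarrow> (F has_vector_derivative f s) (at s)"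
  shows "((\<lambda>R. F R - F 0) \<longlongrightarrow> (LINT s:{0..}|lborel. f s)) at_top"
proof -
  have "((\<lambda>R. LINT s:{0..R}|lborel. f s) \<longlongrightarrow> (LINT s:{0..}|lborel. f s)) at_top"
    using f by (intro tendsto_set_lebesgue_integral_at_top) auto
  moreover have "\<forall>\<^sub>F R in at_top. (LINT s:{0..R}|lborel. f s) = F R - F 0"
    using eventually_ge_at_top[of 0]
  proof eventually_elim
    case (elim R)
    show ?case unfolding set_lebesgue_integral_def
      by (rule integral_FTC_Icc) 
         (use elim F f in \<open>auto intro: continuous_on_subset has_vector_derivative_at_within\<close>)
  qed
  ultimately show ?thesis by (rule Lim_transform_eventually)
qed

lemma integral_FTC_atLeast_limit:
  fixes f F :: "real \<Rightarrow> complex"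
  assumes "continuous_on {0..} f" "set_integrable lborel {0..} f"
    and "\<And>s. s \<ge> 0 \<Longrightarrow> (F has_vector_derivative f s) (at s)" and L: "(F \<longlongrightarrow> L) at_top"
  shows "(LINT s:{0..}|lborel. f s) = L - F 0"
  by (rule tendsto_unique[OF trivial_limit_at_top_linorder tendsto_integral_FTC_atLeast[OF assms(1-3)] tendsto_diff[OF L tendsto_const]])

text \<open>These conditions determine \<open>E\<close>: it is \<open>\<surd>\<pi> / 2\<close> times the error function.\<close>

definition is_gauss_primitive :: "(complex \<Rightarrow> complex) \<Rightarrow> bool" where
  "is_gauss_primitive E \<longleftrightarrow> E 0 = 0 \<and> (\<forall>z. (E has_field_derivative exp (- (z^2))) (at z))"

lemma gauss_primitive_exists: "\<exists>E. is_gauss_primitive E"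
proof -
  have "\<exists>E. \<forall>z\<in>UNIV. (E has_field_derivative exp (- (z^2))) (at z within UNIV :: complex filter)"
    by (rule holomorphic_convex_primitive'[of UNIV "\<lambda>z. exp (- (z^2))"]) (auto intro!: holomorphic_intros)
  then obtain E where E: "(E has_field_derivative exp (- (z^2))) (at z)" for z :: complex
    by (metis UNIV_I)
  have "((\<lambda>z. E z - E 0) has_field_derivative exp (- (z^2))) (at z)" for z
    using DERIV_diff[OF E DERIV_const] by simp
  thus ?thesis unfolding is_gauss_primitive_def by (intro exI[of _ "\<lambda>z. E z - E 0"]) simp
qed

lemma gauss_primitive_odd:
  assumes E: "is_gauss_primitive E" shows "E (- z) = - E z"
proof -
  have d: "(E has_field_derivative exp (- (z^2))) (at z)" for z using E by (simp add: is_gauss_primitive_def)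
  have "((\<lambda>z. E z + E (- z)) has_field_derivative 0) (at z)" for z
  proof -
    have "((\<lambda>z. E (- z)) has_field_derivative exp (- ((-z)^2)) * (-1)) (at z)"
      by (rule DERIV_chain2[OF d]) (auto intro!: derivative_eq_intros)
    from DERIV_add[OF d this] show ?thesis by simp
  qed
  then obtain k where k: "\<And>z. E z + E (- z) = k"
    using has_field_derivative_zero_constant[of UNIV "\<lambda>z. E z + E (- z)"] by auto
  have "k = 0" using k[of 0] E by (simp add: is_gauss_primitive_def)
  with k[of z] show ?thesis by (simp add: add_eq_0_iff)
qed

lemma gauss_primitive_vector_derivative:
  assumes E: "is_gauss_primitive E"
  shows "((\<lambda>s. E (\<alpha> * of_real s + \<beta>)) has_vector_derivative exp (- ((\<alpha> * of_real s + \<beta>)^2)) * \<alpha>) (at s)"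
proof -
  have d: "(E has_field_derivative exp (- (z^2))) (at z)" for z using E by (simp add: is_gauss_primitive_def)
  have "((\<lambda>z. E (\<alpha> * z + \<beta>)) has_field_derivative exp (- ((\<alpha> * of_real s + \<beta>)^2)) * \<alpha>) (at (of_real s))"
    by (rule DERIV_chain2[OF d]) (auto intro!: derivative_eq_intros)
  thus ?thesis by (rule has_vector_derivative_real_field)
qed

lemma gauss_primitive_tendsto_real:
  assumes E: "is_gauss_primitive E"
  shows "((\<lambda>R. E (of_real R)) \<longlongrightarrow> of_real (sqrt pi / 2)) at_top"
proof -
  have g: "integrable lborel (\<lambda>x::real. indicator {0..} x *\<^sub>R exp (- x\<^sup>2))"
    "integral\<^sup>L lborel (\<lambda>x::real. indicator {0..} x *\<^sub>R exp (- x\<^sup>2)) = sqrt pi / 2"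
    using integrable.intros[OF gaussian_moment_0] has_bochner_integral_integral_eq[OF gaussian_moment_0] .
  have eq: "(\<lambda>x. of_real (indicator {0..} x *\<^sub>R exp (- x\<^sup>2))) =
      (\<lambda>x::real. indicator {0..} x *\<^sub>R (exp (- ((1 * of_real x + 0)^2)) * 1 :: complex))"
    by (auto simp: fun_eq_iff indicator_def exp_of_real simp flip: of_real_power of_real_minus)
  have "set_integrable lborel {0..} (\<lambda>x. exp (- ((1 * of_real x + 0)^2)) * 1 :: complex)"
    unfolding set_integrable_def eq[symmetric] by (rule integrable_of_real[OF g(1)])
  moreover have "continuous_on {0..} (\<lambda>x. exp (- ((1 * of_real x + 0)^2)) * 1 :: complex)"
    by (intro continuous_intros)
  ultimately
  have "((\<lambda>R. E (1 * of_real R + 0) - E (1 * of_real 0 + 0)) \<longlongrightarrow>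
      (LINT s:{0..}|lborel. exp (- ((1 * of_real s + 0)^2)) * 1)) at_top"
    by (intro tendsto_integral_FTC_atLeast gauss_primitive_vector_derivative[OF E])
  moreover have "(LINT s:{0..}|lborel. exp (- ((1 * of_real s + 0)^2)) * 1) = (of_real (sqrt pi / 2) :: complex)"
    unfolding set_lebesgue_integral_def eq[symmetric] integral_complex_of_real g(2) ..
  ultimately have "((\<lambda>R. E (1 * of_real R + 0) - E (1 * of_real 0 + 0)) \<longlongrightarrow> of_real (sqrt pi / 2)) at_top"
    by (simp only:)
  thus ?thesis using E by (simp add: is_gauss_primitive_def)
qed

text \<open>On the vertical segment from \<open>Re z\<close> to \<open>z\<close> the integrand \<open>exp (- w\<^sup>2)\<close> is largest at \<open>z\<close>.\<close>

lemma gauss_primitive_vertical: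
  assumes E: "is_gauss_primitive E"
  shows "norm (E z - E (of_real (Re z))) \<le> \<bar>Im z\<bar> * exp ((Im z)^2 - (Re z)^2)"
proof -
  have d: "(E has_field_derivative exp (- (z^2))) (at z)" for z using E by (simp add: is_gauss_primitive_def)
  have "norm (E z - E (of_real (Re z))) \<le> exp ((Im z)^2 - (Re z)^2) * norm (z - of_real (Re z))"
  proof (rule field_differentiable_bound[OF convex_closed_segment has_field_derivative_at_within[OF d]])
    fix w assume "w \<in> closed_segment z (of_real (Re z))"
    then obtain t where t: "0 \<le> t" "t \<le> 1" "w = (1 - t) *\<^sub>R z + t *\<^sub>R of_real (Re z)"
      by (auto simp: in_segment)
    have w: "Re w = Re z" "Im w = (1 - t) * Im z" unfolding t(3) by (simp_all add: algebra_simps)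
    have "(1 - t)^2 * (Im z)^2 \<le> 1 * (Im z)^2"
      using t by (intro mult_right_mono power_le_one) auto
    thus "norm (exp (- (w^2))) \<le> exp ((Im z)^2 - (Re z)^2)"
      by (simp add: Re_power2 w power_mult_distrib)
  qed auto
  also have "norm (z - of_real (Re z)) = \<bar>Im z\<bar>" by (simp add: cmod_def)
  finally show ?thesis by (simp add: mult.commute)
qed

text \<open>Inside the cone \<open>|Im z| < Re z\<close> the Gaussian decays, so the value at \<open>z\<close> and the value at \<open>Re z\<close> have the
  same limit, which is known on the real axis. This replaces a contour shift: it says at once that
  Gaussian integrals do not change when their ray is rotated within the cone or translated.\<close>

lemma gauss_primitive_tendsto:
  assumes E: "is_gauss_primitive E" and \<alpha>: "\<bar>Im \<alpha>\<bar> < Re \<alpha>"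
  shows "((\<lambda>R. E (\<alpha> * of_real R + \<beta>)) \<longlongrightarrow> of_real (sqrt pi / 2)) at_top"
proof -
  define d where "d = (Re \<alpha>)^2 - (Im \<alpha>)^2"
  have d: "d > 0"
    using power_strict_mono[of "\<bar>Im \<alpha>\<bar>" "Re \<alpha>" 2] \<alpha> by (simp add: d_def)
  have Re: "Re \<alpha> > 0" using \<alpha> by linarith
  have "LIM R at_top. Re \<alpha> * R + Re \<beta> :> at_top" using Re by real_asymp
  from filterlim_compose[OF gauss_primitive_tendsto_real[OF E] this]
  have 1: "((\<lambda>R. E (of_real (Re (\<alpha> * of_real R + \<beta>)))) \<longlongrightarrow> of_real (sqrt pi / 2)) at_top" by simp
  define k where "k = 2 * (Im \<alpha> * Im \<beta> - Re \<alpha> * Re \<beta>)"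
  define l where "l = (Im \<beta>)^2 - (Re \<beta>)^2"
  have "((\<lambda>R. E (\<alpha> * of_real R + \<beta>) - E (of_real (Re (\<alpha> * of_real R + \<beta>)))) \<longlongrightarrow> 0) at_top"
  proof (rule Lim_null_comparison)
    have "(\<lambda>R. \<bar>Im \<alpha> * R + Im \<beta>\<bar> * exp (- d * R^2 + k * R + l)) =
          (\<lambda>R. \<bar>(Im \<alpha> * R + Im \<beta>) * exp (- d * R^2 + k * R + l)\<bar>)" by (simp add: abs_mult)
    moreover have "((\<lambda>R. (Im \<alpha> * R + Im \<beta>) * exp (- d * R^2 + k * R + l)) \<longlongrightarrow> 0) at_top"
    proof -
      have "((\<lambda>R. R * exp (- d * R^2 + k * R + l)) \<longlongrightarrow> 0) at_top" "((\<lambda>R. exp (- d * R^2 + k * R + l)) \<longlongrightarrow> 0) at_top"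
        using d by real_asymp+
      from tendsto_add[OF tendsto_mult[OF tendsto_const[of "Im \<alpha>"] this(1)] tendsto_mult[OF tendsto_const[of "Im \<beta>"] this(2)]]
      show ?thesis by (simp add: algebra_simps)
    qed
    ultimately show "((\<lambda>R. \<bar>Im \<alpha> * R + Im \<beta>\<bar> * exp (- d * R^2 + k * R + l)) \<longlongrightarrow> 0) at_top"
      by (metis tendsto_rabs_zero)
    show "\<forall>\<^sub>F R in at_top. norm (E (\<alpha> * of_real R + \<beta>) - E (of_real (Re (\<alpha> * of_real R + \<beta>))))
            \<le> \<bar>Im \<alpha> * R + Im \<beta>\<bar> * exp (- d * R^2 + k * R + l)"
    proof (rule always_eventually[OF allI])
      fix R
      have "(Im (\<alpha> * of_real R + \<beta>))^2 - (Re (\<alpha> * of_real R + \<beta>))^2 = - d * R^2 + k * R + l"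
        by (simp add: d_def k_def l_def power2_eq_square algebra_simps)
      with gauss_primitive_vertical[OF E, of "\<alpha> * of_real R + \<beta>"]
      show "norm (E (\<alpha> * of_real R + \<beta>) - E (of_real (Re (\<alpha> * of_real R + \<beta>))))
            \<le> \<bar>Im \<alpha> * R + Im \<beta>\<bar> * exp (- d * R^2 + k * R + l)" by simp
    qed
  qed
  from tendsto_add[OF this 1] show ?thesis by simp
qed

lemma cone_square: "\<bar>Im \<alpha>\<bar> < Re \<alpha> \<Longrightarrow> Re (\<alpha>^2) > 0"
  using power_strict_mono[of "\<bar>Im \<alpha>\<bar>" "Re \<alpha>" 2] by (simp add: power2_eq_square)

lemma norm_gaussian_ray:
  "norm (exp (- ((\<alpha> * of_real s + \<beta>)^2))) = exp (- Re (\<beta>^2)) * exp ((- 2 * Re (\<alpha> * \<beta>)) * s - Re (\<alpha>^2) * s^2)"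
  unfolding norm_exp_eq_Re exp_add[symmetric] by (simp add: power2_eq_square algebra_simps)

text \<open>The unknown value \<open>E \<beta>\<close> at the starting point stays in the formula; it cancels when two rays are joined
  to a bent line.\<close>

lemma gaussian_ray:
  assumes E: "is_gauss_primitive E" and \<alpha>: "\<bar>Im \<alpha>\<bar> < Re \<alpha>"
  shows "set_integrable lborel {0..} (\<lambda>s. exp (- ((\<alpha> * of_real s + \<beta>)^2)) * \<alpha>)"
    and "(LINT s:{0..}|lborel. exp (- ((\<alpha> * of_real s + \<beta>)^2)) * \<alpha>) = of_real (sqrt pi / 2) - E \<beta>"
    and "set_integrable lborel {0..} (\<lambda>s. (\<alpha> * of_real s + \<beta>) * exp (- ((\<alpha> * of_real s + \<beta>)^2)) * \<alpha>)"
    and "(LINT s:{0..}|lborel. (\<alpha> * of_real s + \<beta>) * exp (- ((\<alpha> * of_real s + \<beta>)^2)) * \<alpha>) = exp (- (\<beta>^2)) / 2"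
proof -
  show 1: "set_integrable lborel {0..} (\<lambda>s. exp (- ((\<alpha> * of_real s + \<beta>)^2)) * \<alpha>)"
    by (rule set_integrable_gaussian_bound[OF _ cone_square[OF \<alpha>], of _ "exp (- Re (\<beta>^2)) * norm \<alpha>" "- 2 * Re (\<alpha> * \<beta>)"])
       (auto intro!: continuous_intros simp only: norm_mult norm_gaussian_ray mult_ac order_refl)
  show "(LINT s:{0..}|lborel. exp (- ((\<alpha> * of_real s + \<beta>)^2)) * \<alpha>) = of_real (sqrt pi / 2) - E \<beta>"
    using integral_FTC_atLeast_limit[OF _ 1 gauss_primitive_vector_derivative[OF E] gauss_primitive_tendsto[OF E \<alpha>]]
    by (simp add: continuous_intros)
  show 2: "set_integrable lborel {0..} (\<lambda>s. (\<alpha> * of_real s + \<beta>) * exp (- ((\<alpha> * of_real s + \<beta>)^2)) * \<alpha>)"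
  proof (rule set_integrable_gaussian_bound[OF _ cone_square[OF \<alpha>], of _ "(norm \<alpha> + norm \<beta>) * exp (- Re (\<beta>^2)) * norm \<alpha>" "1 - 2 * Re (\<alpha> * \<beta>)"])
    fix s :: real assume s: "s \<ge> 0"
    have "norm (\<alpha> * of_real s + \<beta>) \<le> norm \<alpha> * s + norm \<beta> * 1"
      using norm_triangle_ineq[of "\<alpha> * of_real s" \<beta>] s by (simp add: norm_mult)
    also have "\<dots> \<le> norm \<alpha> * exp s + norm \<beta> * exp s"
    proof -
      have "s \<le> exp s" "1 \<le> exp s" using s exp_ge_add_one_self[of s] by linarith+
      thus ?thesis by (intro add_mono mult_left_mono) auto
    qed
    finally have le: "norm (\<alpha> * of_real s + \<beta>) \<le> (norm \<alpha> + norm \<beta>) * exp s" by (simp add: algebra_simps)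
    have "norm ((\<alpha> * of_real s + \<beta>) * exp (- ((\<alpha> * of_real s + \<beta>)^2)) * \<alpha>) \<le>
        ((norm \<alpha> + norm \<beta>) * exp s) * (exp (- Re (\<beta>^2)) * exp ((- 2 * Re (\<alpha> * \<beta>)) * s - Re (\<alpha>^2) * s^2)) * norm \<alpha>"
      unfolding norm_mult[of _ \<alpha>] norm_mult[of "\<alpha> * of_real s + \<beta>"] norm_gaussian_ray
      by (intro mult_right_mono le) auto
    also have "\<dots> = (norm \<alpha> + norm \<beta>) * exp (- Re (\<beta>^2)) * norm \<alpha> * exp ((1 - 2 * Re (\<alpha> * \<beta>)) * s - Re (\<alpha>^2) * s^2)"
    proof -
      have "(1 - 2 * Re (\<alpha> * \<beta>)) * s - Re (\<alpha>^2) * s^2 = s + ((- 2 * Re (\<alpha> * \<beta>)) * s - Re (\<alpha>^2) * s^2)"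
        by (simp add: algebra_simps)
      thus ?thesis by (simp only: exp_add mult_ac)
    qed
    finally show "norm ((\<alpha> * of_real s + \<beta>) * exp (- ((\<alpha> * of_real s + \<beta>)^2)) * \<alpha>) \<le>
      (norm \<alpha> + norm \<beta>) * exp (- Re (\<beta>^2)) * norm \<alpha> * exp ((1 - 2 * Re (\<alpha> * \<beta>)) * s - Re (\<alpha>^2) * s^2)" .
  qed (intro continuous_intros)
  have d: "((\<lambda>s. - exp (- ((\<alpha> * of_real s + \<beta>)^2)) / 2) has_vector_derivative
     (\<alpha> * of_real s + \<beta>) * exp (- ((\<alpha> * of_real s + \<beta>)^2)) * \<alpha>) (at s)" for s
  proof (rule has_vector_derivative_real_field)
    show "((\<lambda>z. - exp (- ((\<alpha> * z + \<beta>)^2)) / 2) has_field_derivative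
     (\<alpha> * of_real s + \<beta>) * exp (- ((\<alpha> * of_real s + \<beta>)^2)) * \<alpha>) (at (of_real s))"
      by (auto intro!: derivative_eq_intros)
  qed
  have lim: "((\<lambda>s. - exp (- ((\<alpha> * of_real s + \<beta>)^2)) / 2) \<longlongrightarrow> 0) at_top"
  proof (rule Lim_null_comparison[OF always_eventually[OF allI]])
    show "norm (- exp (- ((\<alpha> * of_real s + \<beta>)^2)) / 2) \<le>
      exp (- Re (\<beta>^2)) * exp ((- 2 * Re (\<alpha> * \<beta>)) * s - Re (\<alpha>^2) * s^2)" for s
      unfolding norm_divide norm_minus_cancel norm_gaussian_ray by simp
    have "((\<lambda>s. exp (k * s - d * s^2)) \<longlongrightarrow> 0) at_top" if "d > 0" for k d :: real
      using that by real_asymp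
    from tendsto_mult_right_zero[OF this[OF cone_square[OF \<alpha>]]]
    show "((\<lambda>s. exp (- Re (\<beta>^2)) * exp ((- 2 * Re (\<alpha> * \<beta>)) * s - Re (\<alpha>^2) * s^2)) \<longlongrightarrow> 0) at_top" .
  qed
  show "(LINT s:{0..}|lborel. (\<alpha> * of_real s + \<beta>) * exp (- ((\<alpha> * of_real s + \<beta>)^2)) * \<alpha>) = exp (- (\<beta>^2)) / 2"
    using integral_FTC_atLeast_limit[OF _ 2 d lim] by (simp add: continuous_intros)
qed

definition gaussian_wave :: "nat \<Rightarrow> complex \<Rightarrow> complex \<Rightarrow> complex \<Rightarrow> complex" where
  "gaussian_wave p c y u = u ^ p * exp (- (c * u^2) + \<i> * y * u)"

lemma gaussian_wave_ray:
  fixes \<gamma> \<omega> y :: complex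
  assumes E: "is_gauss_primitive E" and cone: "\<bar>Im (\<gamma> * \<omega>)\<bar> < Re (\<gamma> * \<omega>)" and p: "p \<le> 1"
  defines "\<beta> \<equiv> - (\<i> * y / (2 * \<gamma>))"
  shows "set_integrable lborel {0..} (\<lambda>s. gaussian_wave p (\<gamma>^2) y (of_real s * \<omega>) * \<omega>)"
    and "(LINT s:{0..}|lborel. gaussian_wave p (\<gamma>^2) y (of_real s * \<omega>) * \<omega>) =
           exp (- (y^2) / (4 * \<gamma>^2)) / \<gamma> ^ Suc p * 
           (if p = 0 then of_real (sqrt pi / 2) - E \<beta>
            else exp (- (\<beta>^2)) / 2 - \<beta> * (of_real (sqrt pi / 2) - E \<beta>))"
proof -
  define \<alpha> where "\<alpha> = \<gamma> * \<omega>"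
  define T where "T = exp (- (y^2) / (4 * \<gamma>^2))"
  have g0: "\<gamma> \<noteq> 0" using cone by auto
  have \<beta>2: "\<beta>^2 = - (y^2) / (4 * \<gamma>^2)" by (simp add: \<beta>_def power_divide power_mult_distrib)
  \<comment> \<open>completing the square\<close>
  have ex: "exp (- (\<gamma>^2 * (of_real s * \<omega>)^2) + \<i> * y * (of_real s * \<omega>)) = T * exp (- ((\<alpha> * of_real s + \<beta>)^2))" for s
  proof -
    have "2 * \<alpha> * of_real s * \<beta> = - (\<i> * y * (of_real s * \<omega>))"
      using g0 by (simp add: \<alpha>_def \<beta>_def)
    hence "- ((\<alpha> * of_real s + \<beta>)^2) = - (\<gamma>^2 * (of_real s * \<omega>)^2) + \<i> * y * (of_real s * \<omega>) - \<beta>^2"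
      by (simp add: power2_sum \<alpha>_def power_mult_distrib mult_ac)
    thus ?thesis unfolding T_def \<beta>2[symmetric] by (simp flip: exp_add)
  qed
  note ray = gaussian_ray[OF E cone[folded \<alpha>_def], where \<beta> = \<beta>]
  show "set_integrable lborel {0..} (\<lambda>s. gaussian_wave p (\<gamma>^2) y (of_real s * \<omega>) * \<omega>)" (is ?int)
   and "(LINT s:{0..}|lborel. gaussian_wave p (\<gamma>^2) y (of_real s * \<omega>) * \<omega>) =
           exp (- (y^2) / (4 * \<gamma>^2)) / \<gamma> ^ Suc p * 
           (if p = 0 then of_real (sqrt pi / 2) - E \<beta>
            else exp (- (\<beta>^2)) / 2 - \<beta> * (of_real (sqrt pi / 2) - E \<beta>))" (is ?eq)
  proof -
    consider "p = 0" | "p = 1" using p by linarith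
    hence "?int \<and> ?eq"
    proof cases
      case 1
      have "(\<lambda>s. gaussian_wave p (\<gamma>^2) y (of_real s * \<omega>) * \<omega>) =
            (\<lambda>s. T / \<gamma> * (exp (- ((\<alpha> * of_real s + \<beta>)^2)) * \<alpha>))"
        unfolding gaussian_wave_def ex 1 using g0 by (simp add: \<alpha>_def mult_ac)
      thus ?thesis using ray(1,2) 1 by (simp add: T_def)
    next
      case 2
      have eq: "(\<lambda>s. gaussian_wave p (\<gamma>^2) y (of_real s * \<omega>) * \<omega>) =
            (\<lambda>s. T / \<gamma>^2 * ((\<alpha> * of_real s + \<beta>) * exp (- ((\<alpha> * of_real s + \<beta>)^2)) * \<alpha> - \<beta> * (exp (- ((\<alpha> * of_real s + \<beta>)^2)) * \<alpha>)))"
      proof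
        fix s
        have "of_real s * \<omega> * \<omega> = ((\<alpha> * of_real s + \<beta>) * \<alpha> - \<beta> * \<alpha>) / \<gamma>^2"
          using g0 by (simp add: \<alpha>_def field_simps power2_eq_square)
        moreover have "gaussian_wave p (\<gamma>^2) y (of_real s * \<omega>) * \<omega> =
            T * exp (- ((\<alpha> * of_real s + \<beta>)^2)) * (of_real s * \<omega> * \<omega>)"
          unfolding gaussian_wave_def ex 2 by (simp add: mult_ac)
        ultimately show "gaussian_wave p (\<gamma>^2) y (of_real s * \<omega>) * \<omega> =
            T / \<gamma>^2 * ((\<alpha> * of_real s + \<beta>) * exp (- ((\<alpha> * of_real s + \<beta>)^2)) * \<alpha> - \<beta> * (exp (- ((\<alpha> * of_real s + \<beta>)^2)) * \<alpha>))"
          by (simp add: algebra_simps diff_divide_distrib)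
      qed
      show ?thesis unfolding eq using ray 2 g0
        by (simp add: T_def set_integral_diff power2_eq_square)
    qed
    thus ?int ?eq by auto
  qed
qed

text \<open>The bent line comes in from infinity along the direction \<open>- \<omega>'\<close> and leaves along \<open>\<omega>\<close>. For \<open>p = 0\<close> the
  two rays contribute \<open>\<surd>\<pi>/2 - E \<beta>\<close> and \<open>\<surd>\<pi>/2 - E (- \<beta>)\<close>, up to a common factor; for \<open>p = 1\<close> there are
  boundary terms in addition, which cancel. As \<open>E\<close> is odd, the result is the classical Fourier
  transform of the Gaussian, as on the real line.\<close>

lemma gaussian_wave_bent_line:
  assumes cone: "\<bar>Im (\<gamma> * \<omega>)\<bar> < Re (\<gamma> * \<omega>)" "\<bar>Im (\<gamma> * \<omega>')\<bar> < Re (\<gamma> * \<omega>')" and p: "p \<le> 1"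
  shows "set_integrable lborel {0..} (\<lambda>s. gaussian_wave p (\<gamma>^2) y (of_real s * \<omega>) * \<omega>)"
    and "set_integrable lborel {0..} (\<lambda>s. gaussian_wave p (\<gamma>^2) y (of_real s * - \<omega>') * - \<omega>')"
    and "(LINT s:{0..}|lborel. gaussian_wave p (\<gamma>^2) y (of_real s * \<omega>) * \<omega>)
          - (LINT s:{0..}|lborel. gaussian_wave p (\<gamma>^2) y (of_real s * - \<omega>') * - \<omega>')
          = (\<i> * y / (2 * \<gamma>^2)) ^ p * of_real (sqrt pi) / \<gamma> * exp (- (y^2) / (4 * \<gamma>^2))"
proof -
  obtain E where E: "is_gauss_primitive E" using gauss_primitive_exists by blast
  show "set_integrable lborel {0..} (\<lambda>s. gaussian_wave p (\<gamma>^2) y (of_real s * \<omega>) * \<omega>)"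
    by (rule gaussian_wave_ray(1)[OF E cone(1) p])
  have eq: "(\<lambda>s. gaussian_wave p (\<gamma>^2) y (of_real s * - \<omega>') * - \<omega>') =
     (\<lambda>s. (- 1) ^ Suc p * (gaussian_wave p (\<gamma>^2) (- y) (of_real s * \<omega>') * \<omega>'))"
    by (auto simp: gaussian_wave_def power_minus[of "of_real _ * \<omega>'"])
  show "set_integrable lborel {0..} (\<lambda>s. gaussian_wave p (\<gamma>^2) y (of_real s * - \<omega>') * - \<omega>')"
    unfolding eq by (intro set_integrable_mult_right gaussian_wave_ray(1)[OF E cone(2) p])
  have odd: "E (- (\<i> * - y / (2 * \<gamma>))) = - E (- (\<i> * y / (2 * \<gamma>)))"
    using gauss_primitive_odd[OF E, of "- (\<i> * y / (2 * \<gamma>))"] by simp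
  have g0: "\<gamma> \<noteq> 0" using cone by auto
  consider "p = 0" | "p = 1" using p by linarith
  thus "(LINT s:{0..}|lborel. gaussian_wave p (\<gamma>^2) y (of_real s * \<omega>) * \<omega>)
          - (LINT s:{0..}|lborel. gaussian_wave p (\<gamma>^2) y (of_real s * - \<omega>') * - \<omega>')
          = (\<i> * y / (2 * \<gamma>^2)) ^ p * of_real (sqrt pi) / \<gamma> * exp (- (y^2) / (4 * \<gamma>^2))"
    unfolding eq set_integral_mult_right gaussian_wave_ray(2)[OF E cone(1) p] gaussian_wave_ray(2)[OF E cone(2) p] odd
    by cases (use g0 in \<open>simp_all add: field_simps power2_eq_square\<close>)
qed

section \<open>Integration over half-lines\<close>

lemma set_integral_singleton:
  fixes f :: "real \<Rightarrow> complex"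
  shows "set_integrable lborel {a} f" "(LINT s:{a}|lborel. f s) = 0"
proof -
  have eq: "(\<lambda>s. indicat_real {a} s *\<^sub>R f s) = (\<lambda>s. indicat_real {a} s *\<^sub>R f a)"
    by (auto simp: indicator_def)
  show "set_integrable lborel {a} f" unfolding set_integrable_def eq by simp
  show "(LINT s:{a}|lborel. f s) = 0" unfolding set_lebesgue_integral_def eq by simp
qed

lemma set_integral_atLeast_greaterThan:
  fixes f :: "real \<Rightarrow> complex"
  shows "set_integrable lborel {0..} f \<longleftrightarrow> set_integrable lborel {0<..} f"
    and "set_integrable lborel {0<..} f \<Longrightarrow> (LINT s:{0..}|lborel. f s) = (LINT s:{0<..}|lborel. f s)"
proof -
  have eq: "{0::real..} = {0} \<union> {0<..}" by auto
  show "set_integrable lborel {0..} f \<longleftrightarrow> set_integrable lborel {0<..} f"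
  proof
    assume "set_integrable lborel {0..} f"
    thus "set_integrable lborel {0<..} f" by (rule set_integrable_subset) auto
  next
    assume "set_integrable lborel {0<..} f"
    thus "set_integrable lborel {0..} f" unfolding eq
      by (intro set_integrable_Un set_integral_singleton(1)) auto
  qed
  show "(LINT s:{0..}|lborel. f s) = (LINT s:{0<..}|lborel. f s)" if "set_integrable lborel {0<..} f"
    unfolding eq using that
    by (subst set_integral_Un) (auto simp: set_integral_singleton)
qed

text \<open>The integrands are compared at \<open>s > 0\<close> only: the powers in the integrands to come have a mere default
  value at \<open>0\<close>.\<close>

lemma set_integral_square_substitution:
  fixes f g :: "real \<Rightarrow> complex"
  assumes \<kappa>: "\<kappa> > 0" and f: "set_integrable lborel {0..} f"
    and fg: "\<And>s. s > 0 \<Longrightarrow> (2 * \<kappa> * s) *\<^sub>R g (\<kappa> * s^2) = f s"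
  shows "set_integrable lborel {0..} g" and "(LINT r:{0..}|lborel. g r) = (LINT s:{0..}|lborel. f s)"
proof -
  have f': "set_integrable lborel {0<..} f" using f by (simp only: set_integral_atLeast_greaterThan)
  have image: "(\<lambda>s. \<kappa> * s^2) ` {0<..} = {0<..}"
  proof (intro equalityI subsetI)
    fix r :: real assume "r \<in> {0<..}"
    hence "r = \<kappa> * (sqrt (r / \<kappa>))^2" "sqrt (r / \<kappa>) \<in> {0<..}" using \<kappa> by simp_all
    thus "r \<in> (\<lambda>s. \<kappa> * s^2) ` {0<..}" by (rule image_eqI)
  qed (use \<kappa> in auto)
  have "inj_on (\<lambda>s. \<kappa> * s^2) {0<..}" using \<kappa> by (intro inj_onI) (auto simp: power2_eq_iff)
  moreover have "((\<lambda>s. \<kappa> * s^2) has_real_derivative 2 * \<kappa> * s) (at s within {0<..})" for s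
    by (auto intro!: derivative_eq_intros)
  ultimately have cov: "((\<lambda>s. \<bar>2 * \<kappa> * s\<bar> *\<^sub>R g (\<kappa> * s^2)) absolutely_integrable_on {0<..} \<and>
      integral {0<..} (\<lambda>s. \<bar>2 * \<kappa> * s\<bar> *\<^sub>R g (\<kappa> * s^2)) = b) \<longleftrightarrow>
      (g absolutely_integrable_on {0<..} \<and> integral {0<..} g = b)" for b
    using has_absolute_integral_change_of_variables_real[of "{0<..}" "\<lambda>s. \<kappa> * s^2" "\<lambda>s. 2 * \<kappa> * s" g b] image by auto
  have fae: "f absolutely_integrable_on {0<..}"
  proof -
    have "integrable lborel (\<lambda>x. indicat_real {0<..} x *\<^sub>R f x)" using f' by (simp add: set_integrable_def)
    thus ?thesis unfolding set_integrable_def by (subst integrable_completion) auto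
  qed
  have "(\<lambda>s. \<bar>2 * \<kappa> * s\<bar> *\<^sub>R g (\<kappa> * s^2)) absolutely_integrable_on {0<..}"
    using fae by (rule absolutely_integrable_spike[OF _ negligible_empty]) (use fg \<kappa> in auto)
  moreover have "integral {0<..} (\<lambda>s. \<bar>2 * \<kappa> * s\<bar> *\<^sub>R g (\<kappa> * s^2)) = integral {0<..} f"
    by (rule integral_cong) (use fg \<kappa> in auto)
  ultimately have g: "g absolutely_integrable_on {0<..}" "integral {0<..} g = integral {0<..} f"
    using cov[of "integral {0<..} f"] by auto
  have meas: "(\<lambda>r. indicat_real {0<..} r *\<^sub>R g r) \<in> borel_measurable lborel"
  proof -
    have "(\<lambda>s. indicat_real {0<..} s *\<^sub>R f s) \<in> borel_measurable borel"
      using f' unfolding set_integrable_def by (auto dest: borel_measurable_integrable)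
    hence "(\<lambda>r. indicat_real {0<..} (sqrt (r / \<kappa>)) *\<^sub>R f (sqrt (r / \<kappa>))) \<in> borel_measurable borel"
      by (rule measurable_compose[rotated]) measurable
    hence "(\<lambda>r. (1 / (2 * \<kappa> * sqrt (r / \<kappa>))) *\<^sub>R (indicat_real {0<..} (sqrt (r / \<kappa>)) *\<^sub>R f (sqrt (r / \<kappa>)))) \<in> borel_measurable borel"
      by (rule borel_measurable_scaleR[rotated]) measurable
    also have "(\<lambda>r. (1 / (2 * \<kappa> * sqrt (r / \<kappa>))) *\<^sub>R (indicat_real {0<..} (sqrt (r / \<kappa>)) *\<^sub>R f (sqrt (r / \<kappa>))))
              = (\<lambda>r. indicat_real {0<..} r *\<^sub>R g r)"
    proof
      fix r :: real
      show "(1 / (2 * \<kappa> * sqrt (r / \<kappa>))) *\<^sub>R (indicat_real {0<..} (sqrt (r / \<kappa>)) *\<^sub>R f (sqrt (r / \<kappa>)))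
              = indicat_real {0<..} r *\<^sub>R g r"
      proof (cases "r > 0")
        case True
        define q where "q = sqrt (r / \<kappa>)"
        have q: "q > 0" "\<kappa> * q^2 = r" using True \<kappa> by (simp_all add: q_def)
        have "(1 / (2 * \<kappa> * q)) *\<^sub>R f q = g r"
          using fg[OF q(1), symmetric] q \<kappa> by simp
        thus ?thesis using True q(1) by (simp add: q_def[symmetric])
      qed (use \<kappa> in \<open>auto simp: indicator_def zero_less_divide_iff\<close>)
    qed
    finally show ?thesis by simp
  qed
  have g': "set_integrable lborel {0<..} g"
    using g(1) unfolding set_integrable_def by (subst (asm) integrable_completion) (use meas in auto)
  thus "set_integrable lborel {0..} g" by (simp only: set_integral_atLeast_greaterThan)
  show "(LINT r:{0..}|lborel. g r) = (LINT s:{0..}|lborel. f s)"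
    unfolding set_integral_atLeast_greaterThan(2)[OF g'] set_integral_atLeast_greaterThan(2)[OF f']
    using set_borel_integral_eq_integral(2)[OF g'] set_borel_integral_eq_integral(2)[OF f'] g(2) by simp
qed

section \<open>Expansion of the Borel transform into waves\<close>

text \<open>Weights of the Mittag-Leffler series: \<open>n\<^sup>2\<close> times them is \<open>cos (n x)\<close> for \<open>\<nu> = 0\<close> and \<open>n sin (n x)\<close> for
  \<open>\<nu> = 1\<close>, where \<open>n = m + 1\<close>.\<close>

definition fourier_coeff :: "nat \<Rightarrow> real \<Rightarrow> nat \<Rightarrow> complex" where
  "fourier_coeff \<nu> x m =
     (if \<nu> = 0 then of_real (cos (real (Suc m) * x) / real (Suc m)^2)
      else of_real (sin (real (Suc m) * x) / real (Suc m)))"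

lemma norm_fourier_coeff_le: "norm (fourier_coeff \<nu> x m) \<le> 1"
proof -
  have "\<bar>cos (real (Suc m) * x)\<bar> / real (Suc m)^2 \<le> 1 / 1"
    by (intro frac_le one_le_power) auto
  moreover have "\<bar>sin (real (Suc m) * x)\<bar> / real (Suc m) \<le> 1 / 1"
    by (intro frac_le) auto
  ultimately show ?thesis
    unfolding fourier_coeff_def by (simp add: abs_divide del: of_nat_Suc of_real_divide)
qed

lemma summable_fourier_coeff:
  assumes "\<nu> = 0 \<or> 0 < x" "x \<le> pi"
  shows "summable (fourier_coeff \<nu> x)"
proof (cases "\<nu> = 0")
  case True
  have "norm (fourier_coeff \<nu> x m) \<le> 1 / real (Suc m)^2" for m
    using True by (auto simp: fourier_coeff_def abs_divide simp del: of_nat_Suc of_real_divide intro!: divide_right_mono)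
  thus ?thesis by (intro summable_comparison_test'[OF summable_inverse_squares[of 1], of 0])
next
  case False
  have "summable (\<lambda>m. of_real (sin (real (Suc m) * x) / real (Suc m)) :: complex)"
    using sawtooth_sums[of x] assms False by (intro summable_of_real) (auto simp: sums_iff)
  moreover have "fourier_coeff \<nu> x = (\<lambda>m. of_real (sin (real (Suc m) * x) / real (Suc m)))"
    using False by (auto simp: fourier_coeff_def)
  ultimately show ?thesis by simp
qed

text \<open>For \<open>Im u > 0\<close> this is the sum of the geometric series of the waves \<open>exp (i y u)\<close> over
  \<open>y \<in> x + 2\<pi>\<nat>\<close> and, with sign \<open>(-1)\<^sup>\<nu>\<close>, over \<open>y \<in> 2\<pi> - x + 2\<pi>\<nat>\<close>.\<close>

definition wave_ratio :: "nat \<Rightarrow> real \<Rightarrow> complex \<Rightarrow> complex" where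
  "wave_ratio \<nu> x u =
     (exp (\<i> * of_real x * u) + (-1)^\<nu> * exp (\<i> * of_real (2 * pi - x) * u)) / (1 - exp (2 * of_real pi * \<i> * u))"

lemma norm_exp_2pi_i_less_one: "Im u > 0 \<Longrightarrow> norm (exp (2 * of_real pi * \<i> * u)) < 1"
  by (simp add: norm_exp_eq_Re)

lemma trig_quotients_wave_ratio:
  assumes u: "Im u > 0"
  shows "sin (of_real pi * u) \<noteq> 0"
    and "cos (u * (of_real pi - of_real x)) / sin (of_real pi * u) = - \<i> * wave_ratio 0 x u"
    and "sin (u * (of_real pi - of_real x)) / sin (of_real pi * u) = wave_ratio 1 x u"
proof -
  define e where "e = exp (\<i> * of_real pi * u)"
  define q where "q = exp (\<i> * of_real x * u)"
  have e0: "e \<noteq> 0" "q \<noteq> 0" by (simp_all add: e_def q_def)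
  have e2: "exp (2 * of_real pi * \<i> * u) = e^2"
    by (simp add: e_def power2_eq_square mult_ac flip: exp_add)
  have ne: "e^2 \<noteq> 1" using norm_exp_2pi_i_less_one[OF u] by (auto simp: e2)
  have s: "sin (of_real pi * u) = (e - 1 / e) / (2 * \<i>)"
  proof -
    have "exp (\<i> * (of_real pi * u)) = e" "exp (- (\<i> * (of_real pi * u))) = 1 / e"
      by (simp_all only: e_def mult.assoc exp_minus inverse_eq_divide)
    thus ?thesis by (simp only: sin_exp_eq)
  qed
  have "\<i> * (u * (of_real pi - of_real x)) = \<i> * of_real pi * u - \<i> * of_real x * u"
    "- (\<i> * (u * (of_real pi - of_real x))) = \<i> * of_real x * u - \<i> * of_real pi * u"
    "\<i> * of_real (2 * pi - x) * u = 2 * of_real pi * \<i> * u - \<i> * of_real x * u"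
    by (simp_all only: left_diff_distrib right_diff_distrib of_real_diff of_real_mult of_real_numeral mult_ac minus_diff_eq)
  hence eq: "exp (\<i> * (u * (of_real pi - of_real x))) = e / q"
    and eq': "exp (- (\<i> * (u * (of_real pi - of_real x)))) = q / e"
    and e3: "exp (\<i> * of_real (2 * pi - x) * u) = e^2 / q"
    by (simp_all only: exp_diff e_def[symmetric] q_def[symmetric] e2)
  have ne': "e - 1 / e \<noteq> 0" using ne e0 by (simp add: field_simps power2_eq_square)
  have ne2: "1 - e^2 \<noteq> 0" using ne by simp
  have k: "e - 1 / e = - (1 - e^2) / e" using e0 by (simp add: field_simps power2_eq_square)
  show "sin (of_real pi * u) \<noteq> 0" unfolding s using ne' by simp
  show "cos (u * (of_real pi - of_real x)) / sin (of_real pi * u) = - \<i> * wave_ratio 0 x u"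
    unfolding cos_exp_eq s wave_ratio_def eq eq' e3 e2 q_def[symmetric] k
    using ne2 e0 by (simp add: divide_simps power2_eq_square) (simp add: algebra_simps)
  show "sin (u * (of_real pi - of_real x)) / sin (of_real pi * u) = wave_ratio 1 x u"
    unfolding sin_exp_eq[of "u * (of_real pi - of_real x)"] s wave_ratio_def eq eq' e3 e2 q_def[symmetric] k
    using ne2 e0 by (simp add: divide_simps power2_eq_square) (simp add: algebra_simps)
qed

text \<open>What remains of the Laplace integrand, up to a constant and the Gaussian, after the substitution \<open>b \<xi> = u\<^sup>2\<close>.
  It is even in \<open>u\<close>, and regular at \<open>0\<close>.\<close>

definition borel_density :: "nat \<Rightarrow> real \<Rightarrow> complex \<Rightarrow> complex" where
  "borel_density \<nu> x u = u^(2 - 2 * \<nu>) * borel_kernel (fourier_coeff \<nu> x) (u^2)"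

text \<open>In the upper half-plane the partial fractions become a closed form that can be expanded into decaying
  waves. The term \<open>1/2\<close> for \<open>\<nu> = 0\<close> comes from \<open>1 / (2 u\<^sup>2)\<close> in the partial fraction expansion; it produces
  the singular term \<open>i / (\<pi> \<tau>)\<close> in the end.\<close>

lemma borel_density_eq:
  assumes u: "Im u > 0" and \<nu>: "\<nu> \<le> 1" and x: "0 \<le> x" "x \<le> pi" "\<nu> = 0 \<or> 0 < x"
  shows "borel_density \<nu> x u
           = (if \<nu> = 0 then 1/2 else 0) + of_real pi / 2 * (\<i> * u)^(1 - \<nu>) * wave_ratio \<nu> x u"
proof -
  note tr = trig_quotients_wave_ratio[OF u]
  have u0: "u \<noteq> 0" using u by auto
  have nz: "of_nat (Suc m)^2 - u^2 \<noteq> 0" for m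
  proof -
    have "u^2 \<in> slit_plane"
    proof (rule ccontr)
      assume "u^2 \<notin> slit_plane"
      hence "Im (u^2) = 0" "Re (u^2) \<ge> 1" unfolding slit_plane_def by blast+
      hence "Re u = 0" "(Re u)^2 - (Im u)^2 \<ge> 1" using u by (simp_all add: Re_power2 Im_power2)
      thus False by (simp add: power2_eq_square) (smt (verit) mult_nonneg_nonneg u)
    qed
    thus ?thesis by (rule slit_plane_square_neq)
  qed
  have cr: "of_nat (Suc m) * of_real x = (of_real (real (Suc m) * x) :: complex)" for m by simp
  note pf = twisted_partial_fractions[OF tr(1) x(1,2)]
  have summ: "summable (fourier_coeff \<nu> x)" using summable_fourier_coeff x by blast
  have sumk: "summable (\<lambda>m. fourier_coeff \<nu> x m / (of_nat (Suc m)^2 - u^2))"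
    by (rule summable_borel_kernel[OF norm_fourier_coeff_le])
  show ?thesis
  proof (cases "\<nu> = 0")
    case True
    have "borel_kernel (fourier_coeff \<nu> x) (u^2)
            = (\<Sum>m. fourier_coeff \<nu> x m + u^2 * (fourier_coeff \<nu> x m / (of_nat (Suc m)^2 - u^2)))"
      unfolding borel_kernel_def
      by (simp only: suminf_add[OF summ summable_mult[OF sumk], symmetric] suminf_mult[OF sumk])
    also have "\<dots> = (\<Sum>m. cos (of_nat (Suc m) * of_real x) / (of_nat (Suc m)^2 - u^2))"
    proof (intro suminf_cong)
      fix m
      define n :: complex where "n = of_nat (Suc m)"
      have n: "n \<noteq> 0" "n^2 - u^2 \<noteq> 0" using of_nat_neq_0 nz[of m] unfolding n_def by blast+
      have f: "fourier_coeff \<nu> x m = cos (n * of_real x) / n^2"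
        unfolding fourier_coeff_def n_def cr cos_of_real using True by (simp del: of_nat_Suc)
      show "fourier_coeff \<nu> x m + u^2 * (fourier_coeff \<nu> x m / (of_nat (Suc m)^2 - u^2))
             = cos (of_nat (Suc m) * of_real x) / (of_nat (Suc m)^2 - u^2)"
        unfolding f n_def[symmetric] using n by (simp add: divide_simps) (simp add: algebra_simps)
    qed
    also have "\<dots> = 1 / (2 * u^2) - of_real pi * cos (u * (of_real pi - of_real x)) / (2 * u * sin (of_real pi * u))"
      using pf(1) by (simp add: sums_iff)
    also have "\<dots> = 1 / (2 * u^2) - of_real pi / (2 * u) * (cos (u * (of_real pi - of_real x)) / sin (of_real pi * u))"
      by simp
    finally show ?thesis unfolding tr(2) borel_density_def using True u0 by (simp add: field_simps power2_eq_square)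
  next
    case False
    hence \<nu>1: "\<nu> = 1" using \<nu> by simp
    have xpos: "0 < x" using x(3) False by simp
    have f: "fourier_coeff \<nu> x m = sin (of_nat (Suc m) * of_real x) / of_nat (Suc m)" for m
      unfolding fourier_coeff_def cr sin_of_real using \<nu>1 by (simp del: of_nat_Suc)
    have "(\<lambda>m. of_real (sin (real (Suc m) * x) / real (Suc m)) :: complex) sums of_real ((pi - x) / 2)"
      using sawtooth_sums[OF xpos x(2)] by (rule sums_of_real)
    hence 1: "(\<Sum>m. fourier_coeff \<nu> x m) = (of_real pi - of_real x) / 2"
      using \<nu>1 by (simp add: fourier_coeff_def sums_iff)
    have 2: "(\<Sum>m. fourier_coeff \<nu> x m / (of_nat (Suc m)^2 - u^2)) =
      (of_real x - of_real pi) / (2 * u^2) + of_real pi * sin (u * (of_real pi - of_real x)) / (2 * u^2 * sin (of_real pi * u))"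
      unfolding f using pf(2) by (simp only: sums_iff divide_divide_eq_left)
    have "borel_kernel (fourier_coeff \<nu> x) (u^2) = of_real pi / 2 * (sin (u * (of_real pi - of_real x)) / sin (of_real pi * u))"
      unfolding borel_kernel_def 1 2 using u0 tr(1) by (simp add: field_simps)
    thus ?thesis unfolding tr(3) borel_density_def using \<nu>1 by simp
  qed
qed

section \<open>The density on rays and on bent lines\<close>

text \<open>Truncation of the wave expansion of the density; each summand integrates to one term of the Eichler
  integral.\<close>

definition borel_density_partial :: "nat \<Rightarrow> real \<Rightarrow> nat \<Rightarrow> complex \<Rightarrow> complex" where
  "borel_density_partial \<nu> x J u = (if \<nu> = 0 then 1/2 else 0) + of_real pi / 2 * (\<i> * u)^(1 - \<nu>) *
     (\<Sum>j<J. exp (\<i> * of_real (2 * pi * real j + x) * u) + (-1)^\<nu> * exp (\<i> * of_real (2 * pi * real (Suc j) - x) * u))"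

lemma wave_ratio_geometric:
  assumes u: "Im u > 0"
  shows "(\<Sum>j<J. exp (\<i> * of_real (2 * pi * real j + x) * u) + (-1)^\<nu> * exp (\<i> * of_real (2 * pi * real (Suc j) - x) * u))
           = wave_ratio \<nu> x u * (1 - exp (2 * of_real pi * \<i> * u) ^ J)"
proof -
  define E where "E = exp (2 * of_real pi * \<i> * u)"
  define a where "a = exp (\<i> * of_real x * u) + (-1)^\<nu> * exp (\<i> * of_real (2 * pi - x) * u)"
  have ne: "E \<noteq> 1" using norm_exp_2pi_i_less_one[OF u] by (metis E_def norm_one less_irrefl)
  have "exp (\<i> * of_real (2 * pi * real j + x) * u) + (-1)^\<nu> * exp (\<i> * of_real (2 * pi * real (Suc j) - x) * u) = a * E ^ j" for j
  proof -
    have "E ^ j = exp (of_nat j * (2 * of_real pi * \<i> * u))" by (simp only: E_def exp_of_nat_mult)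
    moreover have "\<i> * of_real (2 * pi * real j + x) * u = \<i> * of_real x * u + of_nat j * (2 * of_real pi * \<i> * u)"
      "\<i> * of_real (2 * pi * real (Suc j) - x) * u = \<i> * of_real (2 * pi - x) * u + of_nat j * (2 * of_real pi * \<i> * u)"
      by (simp_all add: algebra_simps)
    ultimately show ?thesis by (simp only: a_def exp_add distrib_right mult.assoc)
  qed
  hence "(\<Sum>j<J. exp (\<i> * of_real (2 * pi * real j + x) * u) + (-1)^\<nu> * exp (\<i> * of_real (2 * pi * real (Suc j) - x) * u))
           = a * (\<Sum>j<J. E ^ j)" by (simp only: sum_distrib_left)
  also have "(\<Sum>j<J. E ^ j) = (1 - E ^ J) / (1 - E)" using ne by (simp add: sum_gp_strict)
  finally show ?thesis by (simp add: wave_ratio_def a_def E_def)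
qed

text \<open>Since \<open>|exp (2 \<pi> i u)| < 1\<close>, this bounds every truncation by \<open>2 |borel_density| + 1\<close>, although the wave
  expansion itself degenerates as \<open>u\<close> tends to \<open>0\<close>.\<close>

lemma borel_density_partial_eq:
  assumes u: "Im u > 0" and "\<nu> \<le> 1" "0 \<le> x" "x \<le> pi" "\<nu> = 0 \<or> 0 < x"
  shows "borel_density_partial \<nu> x J u = borel_density \<nu> x u -
           (borel_density \<nu> x u - (if \<nu> = 0 then 1/2 else 0)) * exp (2 * of_real pi * \<i> * u) ^ J"
  unfolding borel_density_partial_def wave_ratio_geometric[OF u] borel_density_eq[OF assms]
  by (simp add: algebra_simps)

lemma ray_square_slit_plane:
  assumes \<omega>: "Im \<omega> \<noteq> 0" "Re \<omega> \<noteq> 0"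
  shows "(of_real s * \<omega>)^2 \<in> slit_plane"
proof (cases "s = 0")
  case False
  hence "Im ((of_real s * \<omega>)^2) \<noteq> 0" using \<omega> by (simp add: Im_power2)
  thus ?thesis unfolding slit_plane_def by blast
qed (simp add: slit_plane_def)

text \<open>Near \<open>0\<close> the closed form is of no use, as its denominator vanishes there; boundedness follows from continuity of the Mittag-Leffler
  series. Away from \<open>0\<close> the denominator \<open>1 - exp (2 \<pi> i u)\<close> stays away from \<open>0\<close>, because the ray climbs into the
  upper half-plane.\<close>

lemma borel_density_ray:
  assumes \<omega>: "Im \<omega> > 0" "Re \<omega> \<noteq> 0" and \<nu>: "\<nu> \<le> 1" and x: "0 \<le> x" "x \<le> pi" "\<nu> = 0 \<or> 0 < x"
  shows "continuous_on {0..} (\<lambda>s. borel_density \<nu> x (of_real s * \<omega>))"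
    and "\<exists>C. \<forall>s\<ge>0. norm (borel_density \<nu> x (of_real s * \<omega>)) \<le> C * exp s"
proof -
  have \<omega>0: "Im \<omega> \<noteq> 0" using \<omega>(1) by simp
  have "continuous_on slit_plane (borel_kernel (fourier_coeff \<nu> x))"
    by (intro holomorphic_on_imp_continuous_on holomorphic_borel_kernel norm_fourier_coeff_le)
  hence "continuous_on {0..} (\<lambda>s. borel_kernel (fourier_coeff \<nu> x) ((of_real s * \<omega>)^2))"
    by (rule continuous_on_compose2) (auto intro!: continuous_intros ray_square_slit_plane \<omega>0 \<omega>(2))
  thus cont: "continuous_on {0..} (\<lambda>s. borel_density \<nu> x (of_real s * \<omega>))"
    unfolding borel_density_def by (intro continuous_intros)
  have "compact ((\<lambda>s. borel_density \<nu> x (of_real s * \<omega>)) ` {0..1})"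
    by (intro compact_continuous_image continuous_on_subset[OF cont]) auto
  then obtain B where B: "\<And>s. s \<in> {0..1} \<Longrightarrow> norm (borel_density \<nu> x (of_real s * \<omega>)) \<le> B"
    using compact_imp_bounded bounded_iff by (metis (no_types, lifting) imageI)
  define D where "D = 2 / (1 - exp (- (2 * pi * Im \<omega>)))"
  have D1: "exp (- (2 * pi * Im \<omega>)) < 1" using \<omega> by simp
  have D: "norm (wave_ratio \<nu> x (of_real s * \<omega>)) \<le> D" if s: "s \<ge> 1" for s
  proof -
    have im: "s * Im \<omega> \<ge> Im \<omega>" using s \<omega> by simp
    hence im0: "s * Im \<omega> \<ge> 0" using \<omega> by linarith
    have "norm (exp (2 * of_real pi * \<i> * (of_real s * \<omega>))) = exp (- (2 * pi * (s * Im \<omega>)))"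
      by (simp add: norm_exp_eq_Re)
    also have "\<dots> \<le> exp (- (2 * pi * Im \<omega>))" using im by simp
    finally have 1: "norm (1 - exp (2 * of_real pi * \<i> * (of_real s * \<omega>))) \<ge> 1 - exp (- (2 * pi * Im \<omega>))"
      using norm_triangle_ineq2[of 1 "exp (2 * of_real pi * \<i> * (of_real s * \<omega>))"] unfolding norm_one by linarith
    have "norm (exp (\<i> * of_real y * (of_real s * \<omega>))) \<le> 1" if "y \<ge> 0" for y
    proof -
      have "norm (exp (\<i> * of_real y * (of_real s * \<omega>))) = exp (- (y * (s * Im \<omega>)))"
        by (simp add: norm_exp_eq_Re)
      also have "\<dots> \<le> 1" using that im0 by simp
      finally show ?thesis .
    qed
    from this[of x] this[of "2 * pi - x"] have
      "norm (exp (\<i> * of_real x * (of_real s * \<omega>))) \<le> 1" 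
      "norm ((-1)^\<nu> * exp (\<i> * of_real (2 * pi - x) * (of_real s * \<omega>))) \<le> 1"
      using x by (simp_all add: norm_mult norm_power del: of_real_diff)
    hence 2: "norm (exp (\<i> * of_real x * (of_real s * \<omega>)) + (-1)^\<nu> * exp (\<i> * of_real (2 * pi - x) * (of_real s * \<omega>))) \<le> 2"
      by (intro order_trans[OF norm_triangle_ineq]) linarith
    show ?thesis unfolding wave_ratio_def norm_divide D_def
      using 1 2 D1 by (intro frac_le) auto
  qed
  have D0: "D \<ge> 0" using D1 by (simp add: D_def)
  define C where "C = \<bar>B\<bar> + 1/2 + pi / 2 * (1 + norm \<omega>) * D"
  have "norm (borel_density \<nu> x (of_real s * \<omega>)) \<le> C * exp s" if s: "s \<ge> 0" for s
  proof (cases "s \<le> 1")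
    case True
    have "norm (borel_density \<nu> x (of_real s * \<omega>)) \<le> \<bar>B\<bar> * 1" using B[of s] s True by auto
    also have "\<dots> \<le> C * exp s" using D0 s by (intro mult_mono) (auto simp: C_def)
    finally show ?thesis .
  next
    case False
    hence s1: "s \<ge> 1" "Im (of_real s * \<omega>) > 0" using \<omega> by simp_all
    have es: "s \<le> exp s" "1 \<le> exp s" using s exp_ge_add_one_self[of s] by linarith+
    have "norm ((\<i> * (of_real s * \<omega>))^(1 - \<nu>)) \<le> (1 + norm \<omega>) * exp s"
    proof -
      consider "\<nu> = 0" | "\<nu> = 1" using \<nu> by linarith
      thus ?thesis
      proof cases
        case 1
        have "norm ((\<i> * (of_real s * \<omega>))^(1 - \<nu>)) = norm \<omega> * s" using 1 s by (simp add: norm_mult)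
        also have "\<dots> \<le> (1 + norm \<omega>) * exp s" using es s by (intro mult_mono) auto
        finally show ?thesis .
      next
        case 2
        have "1 * 1 \<le> (1 + norm \<omega>) * exp s" using es by (intro mult_mono) auto
        thus ?thesis using 2 by simp
      qed
    qed
    hence "norm (of_real pi / 2 * (\<i> * (of_real s * \<omega>))^(1 - \<nu>) * wave_ratio \<nu> x (of_real s * \<omega>))
       \<le> pi / 2 * ((1 + norm \<omega>) * exp s) * D"
      unfolding norm_mult[of _ "wave_ratio \<nu> x (of_real s * \<omega>)"] norm_mult[of "of_real pi / 2"]
      by (intro mult_mono D s1) auto
    moreover have "norm (if \<nu> = 0 then 1/2 else 0 :: complex) \<le> 1/2 * exp s" using es by auto
    ultimately have "norm (borel_density \<nu> x (of_real s * \<omega>)) \<le> 1/2 * exp s + pi / 2 * ((1 + norm \<omega>) * exp s) * D"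
      unfolding borel_density_eq[OF s1(2) \<nu> x] by (intro order_trans[OF norm_triangle_ineq]) (rule add_mono)
    also have "\<dots> = (1/2 + pi / 2 * (1 + norm \<omega>) * D) * exp s" by (simp add: algebra_simps)
    also have "\<dots> \<le> C * exp s" by (intro mult_right_mono) (auto simp: C_def)
    finally show ?thesis .
  qed
  thus "\<exists>C. \<forall>s\<ge>0. norm (borel_density \<nu> x (of_real s * \<omega>)) \<le> C * exp s" by blast
qed

text \<open>Dominated convergence, with the bound on the truncations noted at \<open>borel_density_partial_eq\<close>.\<close>

lemma gaussian_borel_density_ray:
  assumes \<omega>: "Im \<omega> > 0" "Re \<omega> \<noteq> 0" and \<nu>: "\<nu> \<le> 1" and x: "0 \<le> x" "x \<le> pi" "\<nu> = 0 \<or> 0 < x"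
    and c: "Re (c * \<omega>^2) > 0"
  shows "set_integrable lborel {0..} (\<lambda>s. exp (- (c * (of_real s * \<omega>)^2)) * borel_density \<nu> x (of_real s * \<omega>) * \<omega>)"
    and "(\<lambda>J. LINT s:{0..}|lborel. exp (- (c * (of_real s * \<omega>)^2)) * borel_density_partial \<nu> x J (of_real s * \<omega>) * \<omega>)
           \<longlonglongrightarrow> (LINT s:{0..}|lborel. exp (- (c * (of_real s * \<omega>)^2)) * borel_density \<nu> x (of_real s * \<omega>) * \<omega>)"
proof -
  have nG: "norm (exp (- (c * (of_real s * \<omega>)^2))) = exp (0 * s - Re (c * \<omega>^2) * s^2)" for s
  proof -
    have "- (c * (of_real s * \<omega>)^2) = of_real (- (s^2)) * (c * \<omega>^2)" by (simp add: power_mult_distrib mult_ac)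
    hence "Re (- (c * (of_real s * \<omega>)^2)) = - (s^2) * Re (c * \<omega>^2)"
      by (simp only: Re_complex_of_real Im_complex_of_real times_complex.sel mult_zero_left diff_0_right)
    thus ?thesis by (simp only: norm_exp_eq_Re mult.commute mult_minus_left mult_zero_left diff_0)
  qed
  obtain C where C: "\<And>s. s \<ge> 0 \<Longrightarrow> norm (borel_density \<nu> x (of_real s * \<omega>)) \<le> C * exp s"
    using borel_density_ray(2)[OF \<omega> \<nu> x] by blast
  note cont = borel_density_ray(1)[OF \<omega> \<nu> x]
  show int: "set_integrable lborel {0..} (\<lambda>s. exp (- (c * (of_real s * \<omega>)^2)) * borel_density \<nu> x (of_real s * \<omega>) * \<omega>)"
  proof (rule set_integrable_gaussian_bound[OF _ c, of _ "C * norm \<omega>" 1])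
    fix s :: real assume s: "s \<ge> 0"
    have "norm (exp (- (c * (of_real s * \<omega>)^2)) * borel_density \<nu> x (of_real s * \<omega>) * \<omega>)
        \<le> exp (0 * s - Re (c * \<omega>^2) * s^2) * (C * exp s) * norm \<omega>"
      unfolding norm_mult nG by (intro mult_right_mono mult_left_mono C s) auto
    also have "\<dots> = C * norm \<omega> * exp (1 * s - Re (c * \<omega>^2) * s^2)"
    proof -
      have "exp (1 * s - Re (c * \<omega>^2) * s^2) = exp (0 * s - Re (c * \<omega>^2) * s^2) * exp s"
        unfolding exp_add[symmetric] by (rule arg_cong[where f = exp]) linarith
      thus ?thesis by (simp only: mult_ac)
    qed
    finally show "norm (exp (- (c * (of_real s * \<omega>)^2)) * borel_density \<nu> x (of_real s * \<omega>) * \<omega>)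
        \<le> C * norm \<omega> * exp (1 * s - Re (c * \<omega>^2) * s^2)" .
  qed (intro continuous_intros cont)
  have intG: "set_integrable lborel {0..} (\<lambda>s. exp (- (c * (of_real s * \<omega>)^2)) * \<omega>)"
  proof (rule set_integrable_gaussian_bound[OF _ c, of _ "norm \<omega>" 0])
    show "norm (exp (- (c * (of_real s * \<omega>)^2)) * \<omega>) \<le> norm \<omega> * exp (0 * s - Re (c * \<omega>^2) * s^2)" for s
      unfolding norm_mult nG by (simp only: mult.commute order_refl)
  qed (intro continuous_intros)
  define f where "f s = exp (- (c * (of_real s * \<omega>)^2)) * borel_density \<nu> x (of_real s * \<omega>) * \<omega>" for s
  define g where "g s = exp (- (c * (of_real s * \<omega>)^2)) * \<omega>" for s
  define h where "h J s = exp (- (c * (of_real s * \<omega>)^2)) * borel_density_partial \<nu> x J (of_real s * \<omega>) * \<omega>" for J s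
  have hcont: "continuous_on {0..} (h J)" for J
    unfolding h_def borel_density_partial_def by (intro continuous_intros)
  define k :: complex where "k = (if \<nu> = 0 then 1/2 else 0)"
  have h_eq: "h J s = f s - (f s - k * g s) * exp (2 * of_real pi * \<i> * (of_real s * \<omega>)) ^ J" if "s > 0" for s J
  proof -
    have "Im (of_real s * \<omega>) > 0" using that \<omega> by simp
    note eq = borel_density_partial_eq[OF this \<nu> x]
    show ?thesis
      unfolding h_def f_def g_def k_def eq by (simp only: algebra_simps)
  qed
  have "(\<lambda>J. integral\<^sup>L lborel (\<lambda>s. indicator {0..} s *\<^sub>R h J s)) \<longlonglongrightarrow> integral\<^sup>L lborel (\<lambda>s. indicator {0..} s *\<^sub>R f s)"
  proof (rule integral_dominated_convergence)
    show "(\<lambda>s. indicator {0..} s *\<^sub>R f s) \<in> borel_measurable lborel"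
      using int unfolding set_integrable_def f_def by (rule borel_measurable_integrable)
    show "(\<lambda>s. indicator {0..} s *\<^sub>R h J s) \<in> borel_measurable lborel" for J
      using borel_measurable_continuous_on_indicator[OF _ hcont[of J]] by simp
    show "integrable lborel (\<lambda>s. 2 * norm (indicator {0..} s *\<^sub>R f s) + norm (indicator {0..} s *\<^sub>R g s))"
      using int intG unfolding set_integrable_def f_def g_def
      by (intro Bochner_Integration.integrable_add integrable_mult_right integrable_norm)
    have ne0: "AE s in lborel. s \<noteq> (0::real)" by (rule AE_lborel_singleton)
    show "AE s in lborel. (\<lambda>J. indicator {0..} s *\<^sub>R h J s) \<longlonglongrightarrow> indicator {0..} s *\<^sub>R f s"
      using ne0
    proof eventually_elim
      case (elim s)
      show ?case
      proof (cases "s > 0")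
        case True
        hence "norm (exp (2 * of_real pi * \<i> * (of_real s * \<omega>))) < 1" using \<omega> by (intro norm_exp_2pi_i_less_one) simp
        hence "(\<lambda>J. f s - (f s - k * g s) * exp (2 * of_real pi * \<i> * (of_real s * \<omega>)) ^ J) \<longlonglongrightarrow> f s - (f s - k * g s) * 0"
          by (intro tendsto_intros LIMSEQ_power_zero)
        thus ?thesis using True by (simp add: h_eq)
      qed (use elim in auto)
    qed
    fix J
    show "AE s in lborel. norm (indicator {0..} s *\<^sub>R h J s)
        \<le> 2 * norm (indicator {0..} s *\<^sub>R f s) + norm (indicator {0..} s *\<^sub>R g s)"
      using ne0
    proof eventually_elim
      case (elim s)
      show ?case
      proof (cases "s > 0")
        case True
        hence "norm (exp (2 * of_real pi * \<i> * (of_real s * \<omega>))) < 1" using \<omega> by (intro norm_exp_2pi_i_less_one) simp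
        hence p: "norm (exp (2 * of_real pi * \<i> * (of_real s * \<omega>)) ^ J) \<le> 1" by (simp add: norm_power power_le_one)
        have "norm (k * g s) \<le> 1 * norm (g s)" unfolding norm_mult by (intro mult_right_mono) (auto simp: k_def)
        hence fk: "norm (f s - k * g s) \<le> norm (f s) + norm (g s)"
          by (intro order_trans[OF norm_triangle_ineq4]) simp
        have "norm ((f s - k * g s) * exp (2 * of_real pi * \<i> * (of_real s * \<omega>)) ^ J) \<le> (norm (f s) + norm (g s)) * 1"
          unfolding norm_mult by (intro mult_mono fk p) auto
        hence "norm (h J s) \<le> norm (f s) + (norm (f s) + norm (g s))"
          unfolding h_eq[OF True] by (intro order_trans[OF norm_triangle_ineq4]) simp
        thus ?thesis using True by simp
      qed (use elim in auto)
    qed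
  qed
  thus "(\<lambda>J. LINT s:{0..}|lborel. exp (- (c * (of_real s * \<omega>)^2)) * borel_density_partial \<nu> x J (of_real s * \<omega>) * \<omega>)
           \<longlonglongrightarrow> (LINT s:{0..}|lborel. exp (- (c * (of_real s * \<omega>)^2)) * borel_density \<nu> x (of_real s * \<omega>) * \<omega>)"
    unfolding set_lebesgue_integral_def f_def h_def .
qed

text \<open>The integral of \<open>u\<^sup>p exp (- \<gamma>\<^sup>2 u\<^sup>2 + i y u)\<close> over the real line, or over a bent line, for \<open>p \<le> 1\<close>.\<close>

definition gaussian_line_integral :: "nat \<Rightarrow> complex \<Rightarrow> complex \<Rightarrow> complex" where
  "gaussian_line_integral p \<gamma> y = (\<i> * y / (2 * \<gamma>^2)) ^ p * of_real (sqrt pi) / \<gamma> * exp (- (y^2) / (4 * \<gamma>^2))"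

text \<open>The ray along \<open>\<omega>'\<close> runs in the lower half-plane, where the wave expansion diverges. As the density is
  even, the reflection \<open>u \<mapsto> - u\<close> turns it into a ray along \<open>- \<omega>'\<close> in the upper half-plane. Together with
  the ray along \<open>\<omega>\<close> it forms a bent line above all the poles, along which the waves may be integrated one by one.
  This is where both lateral sums are needed: on a single ray the error function terms of
  \<open>gaussian_wave_ray\<close> would remain.\<close>

lemma bent_line_borel_density:
  assumes cone: "\<bar>Im (\<gamma> * \<omega>)\<bar> < Re (\<gamma> * \<omega>)" "\<bar>Im (\<gamma> * \<omega>')\<bar> < Re (\<gamma> * \<omega>')"
    and \<omega>: "Im \<omega> > 0" "Re \<omega> \<noteq> 0" and \<omega>': "Im \<omega>' < 0" "Re \<omega>' \<noteq> 0"
    and \<nu>: "\<nu> \<le> 1" and x: "0 \<le> x" "x \<le> pi" "\<nu> = 0 \<or> 0 < x"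
  defines "I \<equiv> (\<lambda>\<omega>. LINT s:{0..}|lborel. exp (- (\<gamma>^2 * (of_real s * \<omega>)^2)) * borel_density \<nu> x (of_real s * \<omega>) * \<omega>)"
  shows "(\<lambda>J. (if \<nu> = 0 then 1/2 else 0) * gaussian_line_integral 0 \<gamma> 0 + of_real pi / 2 * \<i>^(1 - \<nu>) *
           (\<Sum>j<J. gaussian_line_integral (1 - \<nu>) \<gamma> (of_real (2 * pi * real j + x))
                 + (-1)^\<nu> * gaussian_line_integral (1 - \<nu>) \<gamma> (of_real (2 * pi * real (Suc j) - x))))
         \<longlonglongrightarrow> I \<omega> + I \<omega>'"
    and "set_integrable lborel {0..} (\<lambda>s. exp (- (\<gamma>^2 * (of_real s * \<omega>)^2)) * borel_density \<nu> x (of_real s * \<omega>) * \<omega>)"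
    and "set_integrable lborel {0..} (\<lambda>s. exp (- (\<gamma>^2 * (of_real s * \<omega>')^2)) * borel_density \<nu> x (of_real s * \<omega>') * \<omega>')"
proof -
  have c: "Re (\<gamma>^2 * \<omega>^2) > 0" "Re (\<gamma>^2 * (- \<omega>')^2) > 0"
    using cone_square[OF cone(1)] cone_square[OF cone(2)] by (simp_all only: power_mult_distrib power2_minus)
  have up: "Im (- \<omega>') > 0" "Re (- \<omega>') \<noteq> 0" using \<omega>' by auto
  have even: "borel_density \<nu> x (- u) = borel_density \<nu> x u" for u
    by (cases "\<nu> = 0") (simp_all add: borel_density_def)
  have refl: "exp (- (\<gamma>^2 * (of_real s * - \<omega>')^2)) * borel_density \<nu> x (of_real s * - \<omega>') * - \<omega>'
      = - (exp (- (\<gamma>^2 * (of_real s * \<omega>')^2)) * borel_density \<nu> x (of_real s * \<omega>') * \<omega>')" for s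
    by (simp add: even)
  show "set_integrable lborel {0..} (\<lambda>s. exp (- (\<gamma>^2 * (of_real s * \<omega>)^2)) * borel_density \<nu> x (of_real s * \<omega>) * \<omega>)"
    by (rule gaussian_borel_density_ray(1)[OF \<omega> \<nu> x c(1)])
  have int': "set_integrable lborel {0..} (\<lambda>s. - (exp (- (\<gamma>^2 * (of_real s * \<omega>')^2)) * borel_density \<nu> x (of_real s * \<omega>') * \<omega>'))"
    using gaussian_borel_density_ray(1)[OF up \<nu> x c(2)] unfolding refl .
  from set_integrable_mult_right[OF this, of "-1"]
  show int'': "set_integrable lborel {0..} (\<lambda>s. exp (- (\<gamma>^2 * (of_real s * \<omega>')^2)) * borel_density \<nu> x (of_real s * \<omega>') * \<omega>')"
    by simp
  define P where "P J \<omega> = (LINT s:{0..}|lborel. exp (- (\<gamma>^2 * (of_real s * \<omega>)^2)) * borel_density_partial \<nu> x J (of_real s * \<omega>) * \<omega>)" for J \<omega>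
  have lim: "(\<lambda>J. P J \<omega>) \<longlonglongrightarrow> I \<omega>" unfolding P_def I_def by (rule gaussian_borel_density_ray(2)[OF \<omega> \<nu> x c(1)])
  have "(\<lambda>J. P J (- \<omega>')) \<longlonglongrightarrow> (LINT s:{0..}|lborel. - (exp (- (\<gamma>^2 * (of_real s * \<omega>')^2)) * borel_density \<nu> x (of_real s * \<omega>') * \<omega>'))"
    unfolding P_def refl[symmetric] by (rule gaussian_borel_density_ray(2)[OF up \<nu> x c(2)])
  also have "(LINT s:{0..}|lborel. - (exp (- (\<gamma>^2 * (of_real s * \<omega>')^2)) * borel_density \<nu> x (of_real s * \<omega>') * \<omega>')) = - I \<omega>'"
    unfolding I_def set_lebesgue_integral_def scaleR_minus_right by (rule Bochner_Integration.integral_minus)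
  finally have lim': "(\<lambda>J. P J (- \<omega>')) \<longlonglongrightarrow> - I \<omega>'" .
  define k :: complex where "k = (if \<nu> = 0 then 1/2 else 0)"
  define K where "K = of_real pi / 2 * \<i>^(1 - \<nu>)"
  have p: "(0::nat) \<le> 1" "1 - \<nu> \<le> 1" using \<nu> by auto
  have gw: "exp (- (\<gamma>^2 * u^2)) * borel_density_partial \<nu> x J u * w = k * (gaussian_wave 0 (\<gamma>^2) 0 u * w) +
      K * (\<Sum>j<J. gaussian_wave (1 - \<nu>) (\<gamma>^2) (of_real (2 * pi * real j + x)) u * w
               + (-1)^\<nu> * (gaussian_wave (1 - \<nu>) (\<gamma>^2) (of_real (2 * pi * real (Suc j) - x)) u * w))" for u w J
  proof -
    have "gaussian_wave (1 - \<nu>) (\<gamma>^2) (of_real y) u = exp (- (\<gamma>^2 * u^2)) * u^(1 - \<nu>) * exp (\<i> * of_real y * u)" for y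
      by (simp only: gaussian_wave_def exp_add mult_ac)
    moreover have "gaussian_wave 0 (\<gamma>^2) 0 u = exp (- (\<gamma>^2 * u^2))" by (simp add: gaussian_wave_def)
    ultimately show ?thesis
      unfolding borel_density_partial_def k_def[symmetric] K_def
      by (simp only: power_mult_distrib distrib_left distrib_right sum_distrib_left sum_distrib_right sum.distrib mult_ac)
  qed
  have P_eq: "P J \<upsilon> = k * (LINT s:{0..}|lborel. gaussian_wave 0 (\<gamma>^2) 0 (of_real s * \<upsilon>) * \<upsilon>) +
      K * (\<Sum>j<J. (LINT s:{0..}|lborel. gaussian_wave (1 - \<nu>) (\<gamma>^2) (of_real (2 * pi * real j + x)) (of_real s * \<upsilon>) * \<upsilon>)
         + (-1)^\<nu> * (LINT s:{0..}|lborel. gaussian_wave (1 - \<nu>) (\<gamma>^2) (of_real (2 * pi * real (Suc j) - x)) (of_real s * \<upsilon>) * \<upsilon>))"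
    if ints': "\<forall>p\<le>1. \<forall>y. set_integrable lborel {0..} (\<lambda>s. gaussian_wave p (\<gamma>^2) y (of_real s * \<upsilon>) * \<upsilon>)" for J \<upsilon>
  proof -
    note int = ints'[rule_format]
    have int2: "set_integrable lborel {0..} (\<lambda>s. (-1)^\<nu> * (gaussian_wave (1 - \<nu>) (\<gamma>^2) y (of_real s * \<upsilon>) * \<upsilon>))" for y
      by (intro set_integrable_mult_right int p)
    have ints: "set_integrable lborel {0..} (\<lambda>s. gaussian_wave (1 - \<nu>) (\<gamma>^2) y (of_real s * \<upsilon>) * \<upsilon>
               + (-1)^\<nu> * (gaussian_wave (1 - \<nu>) (\<gamma>^2) y' (of_real s * \<upsilon>) * \<upsilon>))" for y y'
      by (intro set_integral_add(1) int int2 p)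
    have intsum: "set_integrable lborel {0..} (\<lambda>s. (\<Sum>j<J. gaussian_wave (1 - \<nu>) (\<gamma>^2) (of_real (2 * pi * real j + x)) (of_real s * \<upsilon>) * \<upsilon>
               + (-1)^\<nu> * (gaussian_wave (1 - \<nu>) (\<gamma>^2) (of_real (2 * pi * real (Suc j) - x)) (of_real s * \<upsilon>) * \<upsilon>)))"
      unfolding set_integrable_def scaleR_sum_right
      by (intro Bochner_Integration.integrable_sum ints[unfolded set_integrable_def])
    have sum: "(LINT s:{0..}|lborel. (\<Sum>j<J. F j s)) = (\<Sum>j<J. LINT s:{0..}|lborel. F j s)"
      if "\<And>j. set_integrable lborel {0..} (F j)" for F :: "nat \<Rightarrow> real \<Rightarrow> complex"
      unfolding set_lebesgue_integral_def scaleR_sum_right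
      by (intro Bochner_Integration.integral_sum that[unfolded set_integrable_def])
    show ?thesis unfolding P_def gw
      by (subst set_integral_add(2)[OF set_integrable_mult_right[OF int] set_integrable_mult_right[OF intsum]])
         (simp_all only: p set_integral_mult_right sum[OF ints] set_integral_add(2)[OF int int2])
  qed
  note bent = gaussian_wave_bent_line[OF cone]
  have P1: "\<forall>p\<le>1. \<forall>y. set_integrable lborel {0..} (\<lambda>s. gaussian_wave p (\<gamma>^2) y (of_real s * \<omega>) * \<omega>)"
    and P2: "\<forall>p\<le>1. \<forall>y. set_integrable lborel {0..} (\<lambda>s. gaussian_wave p (\<gamma>^2) y (of_real s * - \<omega>') * - \<omega>')"
    using bent(1,2) by blast+
  have alg: "(k * a + K * (\<Sum>j<J. f j + (-1)^\<nu> * g j)) - (k * a' + K * (\<Sum>j<J. f' j + (-1)^\<nu> * g' j))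
      = k * (a - a') + K * (\<Sum>j<J. (f j - f' j) + (-1)^\<nu> * (g j - g' j))"
    for a a' :: complex and f f' g g' :: "nat \<Rightarrow> complex" and J :: nat
    by (simp only: right_diff_distrib sum_subtractf sum.distrib distrib_left) simp
  have "P J \<omega> - P J (- \<omega>') = k * gaussian_line_integral 0 \<gamma> 0 + K * 
       (\<Sum>j<J. gaussian_line_integral (1 - \<nu>) \<gamma> (of_real (2 * pi * real j + x))
                 + (-1)^\<nu> * gaussian_line_integral (1 - \<nu>) \<gamma> (of_real (2 * pi * real (Suc j) - x)))" for J
    unfolding P_eq[OF P1] P_eq[OF P2] gaussian_line_integral_def bent(3)[OF p(1), symmetric] bent(3)[OF p(2), symmetric]
    by (rule alg)
  with tendsto_diff[OF lim lim'] show "(\<lambda>J. (if \<nu> = 0 then 1/2 else 0) * gaussian_line_integral 0 \<gamma> 0 + of_real pi / 2 * \<i>^(1 - \<nu>) *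
           (\<Sum>j<J. gaussian_line_integral (1 - \<nu>) \<gamma> (of_real (2 * pi * real j + x))
                 + (-1)^\<nu> * gaussian_line_integral (1 - \<nu>) \<gamma> (of_real (2 * pi * real (Suc j) - x))))
         \<longlonglongrightarrow> I \<omega> + I \<omega>'" by (simp add: k_def K_def)
qed

section \<open>The Eichler integral and its Borel transform\<close>

text \<open>The congruence class of \<open>k\<close> modulo \<open>2 N\<close> splits into \<open>2 N j + k\<close> and \<open>- (2 N (j + 1) - k)\<close> with \<open>j \<ge> 0\<close>. On
  the first progression \<open>sgn n\<close> is \<open>1\<close>, except that \<open>n = 0\<close> occurs when \<open>k = 0\<close>; then \<open>\<nu> = 0\<close>, and the factor
  \<open>n\<close> removes the term. On the second, \<open>sgn n \<cdot> n\<^sup>1\<^sup>-\<^sup>\<nu>\<close> equals \<open>(-1)\<^sup>\<nu> |n|\<^sup>1\<^sup>-\<^sup>\<nu>\<close>.\<close>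

lemma EI_sums:
  assumes N: "N \<ge> 1" and \<nu>: "\<nu> \<le> 1" and k: "k \<in> index_set \<nu> N" and \<tau>: "Im \<tau> > 0"
  defines "q \<equiv> (\<lambda>n::nat. exp (of_real pi * \<i> * \<tau> * of_nat n ^ 2 / (2 * of_nat N)))"
  shows "(\<lambda>j. of_nat (2 * N * j + k) ^ (1 - \<nu>) * q (2 * N * j + k)
            + (-1)^\<nu> * (of_nat (2 * N * Suc j - k) ^ (1 - \<nu>) * q (2 * N * Suc j - k))) sums EI \<nu> N k \<tau>"
proof -
  define f where "f n = of_int (sgn n) * of_int n ^ (1 - \<nu>)
        * (if [n = int k] (mod 2 * int N) then 1 else 0)
        * exp (2 * of_real pi * \<i> * \<tau> * (of_int n ^ 2 / (4 * of_nat N)))" for n :: int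
  have kN: "k \<le> N" "\<nu> = 1 \<Longrightarrow> k \<ge> 1"
    using k N \<nu> by (auto simp: index_set_def split: if_splits)
  define a where "a j = 2 * N * j + k" for j
  define b where "b j = 2 * N * Suc j - k" for j
  have b_int: "int (b j) = 2 * int N * int (Suc j) - int k" for j
    using kN(1) by (simp add: b_def of_nat_diff algebra_simps trans_le_add1)
  have aj: "a j \<ge> j" for j using N by (auto simp: a_def trans_le_add1)
  have bj: "b j \<ge> j" "b j > 0" for j
  proof -
    have "int N * int j \<ge> 1 * int j" using N by (intro mult_right_mono) auto
    hence "int (b j) \<ge> int j + 1" unfolding b_int using kN(1) N by (simp add: algebra_simps)
    thus "b j \<ge> j" "b j > 0" by linarith+
  qed
  have cong_iff: "[n = int k] (mod 2 * int N) \<longleftrightarrow> n \<in> range (\<lambda>j. int (a j)) \<union> range (\<lambda>j. - int (b j))" for n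
  proof
    assume "[n = int k] (mod 2 * int N)"
    then obtain t where t: "n = int k + 2 * int N * t"
      by (metis cong_iff_lin cong_sym)
    show "n \<in> range (\<lambda>j. int (a j)) \<union> range (\<lambda>j. - int (b j))"
    proof (cases "t \<ge> 0")
      case True
      hence "n = int (a (nat t))" using t by (simp add: a_def)
      thus ?thesis by blast
    next
      case False
      hence "n = - int (b (nat (- t - 1)))" using t by (simp add: b_int algebra_simps)
      thus ?thesis by blast
    qed
  next
    assume "n \<in> range (\<lambda>j. int (a j)) \<union> range (\<lambda>j. - int (b j))"
    then obtain j where "n = int (a j) \<or> n = - int (b j)" by blast
    thus "[n = int k] (mod 2 * int N)"
    proof
      assume "n = int (a j)"
      hence "n - int k = 2 * int N * int j" by (simp add: a_def)
      thus ?thesis by (simp add: cong_iff_dvd_diff)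
    next
      assume "n = - int (b j)"
      hence "n - int k = 2 * int N * (- int (Suc j))" by (simp add: b_int algebra_simps)
      thus ?thesis unfolding cong_iff_dvd_diff by (metis dvd_triv_left)
    qed
  qed
  have ex: "exp (2 * of_real pi * \<i> * \<tau> * (of_int n ^ 2 / (4 * of_nat N))) = q (nat \<bar>n\<bar>)" for n
  proof -
    have "(of_nat (nat \<bar>n\<bar>) :: complex)^2 = of_int n ^ 2"
      by (simp add: of_nat_nat flip: of_int_power)
    thus ?thesis unfolding q_def using N by (simp add: field_simps)
  qed
  have fa: "f (int (a j)) = of_nat (a j) ^ (1 - \<nu>) * q (a j)" for j
  proof -
    have "[int (a j) = int k] (mod 2 * int N)" unfolding cong_iff by blast
    moreover have "of_int (sgn (int (a j))) * of_int (int (a j)) ^ (1 - \<nu>) = (of_nat (a j) ^ (1 - \<nu>) :: complex)"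
    proof (cases "a j = 0")
      case True
      hence "\<nu> = 0" using kN \<nu> by (cases "\<nu> = 0") (auto simp: a_def)
      thus ?thesis using True by simp
    qed simp
    ultimately show ?thesis unfolding f_def ex by simp
  qed
  have fb: "f (- int (b j)) = (-1)^\<nu> * (of_nat (b j) ^ (1 - \<nu>) * q (b j))" for j
  proof -
    have "[- int (b j) = int k] (mod 2 * int N)" unfolding cong_iff by blast
    moreover have "of_int (sgn (- int (b j))) * of_int (- int (b j)) ^ (1 - \<nu>) = ((-1)^\<nu> * of_nat (b j) ^ (1 - \<nu>) :: complex)"
    proof -
      have "\<nu> = 0 \<or> \<nu> = 1" using \<nu> by linarith
      thus ?thesis using bj(2)[of j] by (auto simp: sgn_if)
    qed
    ultimately show ?thesis unfolding f_def ex by simp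
  qed
  define \<alpha> where "\<alpha> = pi * Im \<tau> / (2 * real N)"
  have \<alpha>: "\<alpha> > 0" using \<tau> N by (simp add: \<alpha>_def)
  have nq: "norm (q n) = exp (- \<alpha> * real n ^ 2)" for n
  proof -
    have "of_real pi * \<i> * \<tau> * of_nat n ^ 2 / (2 * of_nat N) = of_real (pi * real n ^ 2 / (2 * real N)) * (\<i> * \<tau>)" by simp
    hence "Re (of_real pi * \<i> * \<tau> * of_nat n ^ 2 / (2 * of_nat N)) = pi * real n ^ 2 / (2 * real N) * Re (\<i> * \<tau>)"
      by (simp only: Re_complex_of_real Im_complex_of_real times_complex.sel mult_zero_left diff_0_right)
    thus ?thesis by (simp add: q_def norm_exp_eq_Re \<alpha>_def)
  qed
  have bound: "norm (of_nat n ^ (1 - \<nu>) * q n) \<le> exp (1 / \<alpha>) * exp (- 1) ^ j" if "j \<le> n" for n j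
  proof -
    have "norm (of_nat n ^ (1 - \<nu>) * q n) = real n ^ (1 - \<nu>) * exp (- \<alpha> * real n ^ 2)"
      by (simp add: norm_mult norm_power nq)
    also have "real n ^ (1 - \<nu>) \<le> exp (real n)"
      using \<nu> exp_ge_add_one_self[of "real n"] by (cases "\<nu> = 0") (auto simp del: exp_ge_add_one_self)
    hence "real n ^ (1 - \<nu>) * exp (- \<alpha> * real n ^ 2) \<le> exp (real n) * exp (- \<alpha> * real n ^ 2)"
      by (intro mult_right_mono) auto
    also have "\<dots> = exp (real n - \<alpha> * real n ^ 2)" by (simp flip: exp_add)
    also have "\<dots> \<le> exp (1 / \<alpha> - real n)"
    proof -
      have "1 / \<alpha> - real n - (real n - \<alpha> * real n ^ 2) = \<alpha> * (real n - 1 / \<alpha>)^2"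
        using \<alpha> by (simp add: power2_eq_square field_simps)
      also have "\<dots> \<ge> 0" using \<alpha> by simp
      finally show ?thesis by simp
    qed
    also have "\<dots> \<le> exp (1 / \<alpha> + real j * (- 1))" using that by simp
    also have "\<dots> = exp (1 / \<alpha>) * exp (- 1) ^ j" unfolding exp_add exp_of_nat_mult ..
    finally show ?thesis .
  qed
  have geo: "summable (\<lambda>j. exp (1 / \<alpha>) * exp (- 1 :: real) ^ j)"
    by (intro summable_mult summable_geometric) simp
  have sa: "summable (\<lambda>j. norm (f (int (a j))))"
    unfolding fa by (rule summable_comparison_test'[OF geo, of 0]) (use bound[OF aj] in simp)
  have sb: "summable (\<lambda>j. norm (f (- int (b j))))"
    unfolding fb by (rule summable_comparison_test'[OF geo, of 0])
      (use bound[OF bj(1)] in \<open>simp add: norm_mult[of "(-1)^\<nu>"] norm_power\<close>)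
  have inja: "inj (\<lambda>j. int (a j))" using N by (auto simp: inj_on_def a_def)
  have injb: "inj (\<lambda>j. - int (b j))"
  proof (rule injI)
    fix i j assume "- int (b i) = - int (b j)"
    hence "2 * int N * int (Suc i) = 2 * int N * int (Suc j)" unfolding b_int by linarith
    thus "i = j" using N by simp
  qed
  have "(f has_sum (\<Sum>j. f (int (a j)))) (range (\<lambda>j. int (a j)))"
    unfolding has_sum_reindex[OF inja] o_def
    by (rule norm_summable_imp_has_sum[OF sa summable_sums[OF summable_norm_cancel[OF sa]]])
  moreover have "(f has_sum (\<Sum>j. f (- int (b j)))) (range (\<lambda>j. - int (b j)))"
    unfolding has_sum_reindex[OF injb] o_def
    by (rule norm_summable_imp_has_sum[OF sb summable_sums[OF summable_norm_cancel[OF sb]]])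
  moreover have "range (\<lambda>j. int (a j)) \<inter> range (\<lambda>j. - int (b j)) = {}"
  proof -
    have "int (a i) \<noteq> - int (b j)" for i j using bj(2)[of j] by linarith
    thus ?thesis by blast
  qed
  ultimately have "(f has_sum ((\<Sum>j. f (int (a j))) + (\<Sum>j. f (- int (b j))))) (range (\<lambda>j. int (a j)) \<union> range (\<lambda>j. - int (b j)))"
    by (rule has_sum_Un_disjoint)
  also have "?this \<longleftrightarrow> (f has_sum ((\<Sum>j. f (int (a j))) + (\<Sum>j. f (- int (b j))))) UNIV"
    by (rule has_sum_cong_neutral) (auto simp: f_def cong_iff)
  finally have "EI \<nu> N k \<tau> = (\<Sum>j. f (int (a j))) + (\<Sum>j. f (- int (b j)))"
    unfolding EI_def f_def by (rule infsumI)
  moreover have "(\<lambda>j. f (int (a j)) + f (- int (b j))) sums ((\<Sum>j. f (int (a j))) + (\<Sum>j. f (- int (b j))))"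
    by (intro sums_add summable_sums summable_norm_cancel[OF sa] summable_norm_cancel[OF sb])
  ultimately show ?thesis unfolding fa fb by (simp only: a_def b_def)
qed

lemma summable_fourier_moment:
  assumes "\<nu> = 0 \<or> 0 < x" "x \<le> pi"
  shows "summable (\<lambda>m. fourier_coeff \<nu> x m / of_nat (Suc m)^(2 * l))"
proof (cases l)
  case 0
  thus ?thesis using summable_fourier_coeff[OF assms] by simp
next
  case (Suc l')
  show ?thesis
  proof (rule summable_comparison_test'[OF summable_inverse_squares[of 1], of 0])
    fix m
    have "norm (fourier_coeff \<nu> x m / of_nat (Suc m)^(2 * l)) = norm (fourier_coeff \<nu> x m) / real (Suc m)^(2 * l)"
      by (simp only: norm_divide norm_power norm_of_nat)
    also have "\<dots> \<le> 1 / real (Suc m)^2"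
      using norm_fourier_coeff_le Suc by (intro frac_le power_increasing) auto
    finally show "norm (fourier_coeff \<nu> x m / of_nat (Suc m)^(2 * l)) \<le> 1 / real (Suc m)^2" .
  qed
qed

text \<open>The factor common to all \<open>EI_coeff \<nu> N k l\<close>.\<close>

definition EI_prefactor :: "nat \<Rightarrow> nat \<Rightarrow> complex" where
  "EI_prefactor \<nu> N = 2 * \<i>^\<nu> / (of_real pi * csqrt (2 * \<i> * of_nat N))"

text \<open>The Gamma factor cancels, and what is left is geometric in \<open>l\<close> for each fixed \<open>m\<close>.\<close>

lemma borel_fps_EI_series:
  assumes N: "N \<ge> 1" and \<nu>: "\<nu> \<le> 1" and k: "k \<in> index_set \<nu> N"
  defines "b \<equiv> 2 * of_nat N / (of_real pi * \<i>)"
  shows "fps_nth (borel_fps (3/2 - real \<nu>) (EI_series \<nu> N k)) l =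
    EI_prefactor \<nu> N * b powr (3/2 - of_nat \<nu>) * b^l * (\<Sum>m. fourier_coeff \<nu> (pi * real k / real N) m / of_nat (Suc m)^(2 * l))"
proof -
  define x where "x = pi * real k / real N"
  have kN: "k \<le> N" "\<nu> = 1 \<Longrightarrow> k \<ge> 1"
    using k N \<nu> by (auto simp: index_set_def split: if_splits)
  have x: "\<nu> = 0 \<or> 0 < x" "x \<le> pi"
    using kN N \<nu> by (auto simp: x_def field_simps le_Suc_eq)
  have b0: "b \<noteq> 0" using N by (simp add: b_def)
  have gam: "Gamma z \<noteq> 0" if "Re z > 0" for z :: complex
    using that by (auto simp: Gamma_eq_zero_iff elim!: nonpos_Ints_cases)
  have pw: "b powr (s + of_nat l) = b powr s * b^l" for s
    using b0 by (simp add: powr_add powr_nat')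
  have nth: "fps_nth (borel_fps (3/2 - real \<nu>) (EI_series \<nu> N k)) l
      = EI_coeff \<nu> N k l / Gamma (of_nat l + of_real (3/2 - real \<nu>))"
    by (simp add: borel_fps_def EI_series_def)
  note S = summable_fourier_moment[OF x, of l]
  consider "\<nu> = 0" | "\<nu> = 1" using \<nu> by linarith
  thus ?thesis
  proof cases
    case 1
    define d where "d m = cos (pi * real k * real (Suc m) / real N) / real (Suc m) ^ (2 * l + 2)" for m
    have eq: "fourier_coeff \<nu> x m / of_nat (Suc m)^(2 * l) = of_real (d m)" for m
    proof -
      have "real (Suc m) * x = pi * real k * real (Suc m) / real N" by (simp add: x_def)
      thus ?thesis using 1 by (simp add: fourier_coeff_def d_def power_add power2_eq_square mult_ac del: of_nat_Suc)
    qed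
    have "summable d" using S unfolding eq by (simp only: summable_complex_of_real)
    from suminf_of_real[OF this, where 'a = complex]
    have "of_real (suminf d) = (\<Sum>m. fourier_coeff \<nu> x m / of_nat (Suc m)^(2 * l))" unfolding eq .
    moreover have "EI_coeff \<nu> N k l = EI_prefactor \<nu> N * b powr (3/2 + of_nat l) * Gamma (3/2 + of_nat l) * of_real (suminf d)"
      unfolding EI_coeff_def EI_prefactor_def b_def d_def using 1 by simp
    ultimately show ?thesis
      unfolding nth x_def[symmetric] using gam[of "3/2 + of_nat l"] pw[of "3/2"] 1 by (simp add: add.commute)
  next
    case 2
    define d where "d m = sin (pi * real k * real (Suc m) / real N) / real (Suc m) ^ (2 * l + 1)" for m
    have eq: "fourier_coeff \<nu> x m / of_nat (Suc m)^(2 * l) = of_real (d m)" for m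
    proof -
      have "real (Suc m) * x = pi * real k * real (Suc m) / real N" by (simp add: x_def)
      thus ?thesis using 2 by (simp add: fourier_coeff_def d_def power_add power2_eq_square mult_ac del: of_nat_Suc)
    qed
    have "summable d" using S unfolding eq by (simp only: summable_complex_of_real)
    from suminf_of_real[OF this, where 'a = complex]
    have "of_real (suminf d) = (\<Sum>m. fourier_coeff \<nu> x m / of_nat (Suc m)^(2 * l))" unfolding eq .
    moreover have "EI_coeff \<nu> N k l = EI_prefactor \<nu> N * b powr (1/2 + of_nat l) * Gamma (1/2 + of_nat l) * of_real (suminf d)"
      unfolding EI_coeff_def EI_prefactor_def b_def d_def using 2 by simp
    ultimately show ?thesis
      unfolding nth x_def[symmetric] using gam[of "1/2 + of_nat l"] pw[of "1/2"] 2 by (simp add: add.commute)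
  qed
qed

lemma csqrt_i_times:
  assumes "r > 0" shows "csqrt (\<i> * of_real r) = of_real (sqrt (r / 2)) * (1 + \<i>)"
proof (rule csqrt_unique)
  have "(of_real (sqrt (r / 2)) :: complex)^2 = of_real r / 2"
    using assms by (simp flip: of_real_power)
  thus "(of_real (sqrt (r / 2)) * (1 + \<i>))^2 = \<i> * of_real r"
    by (simp add: power_mult_distrib power2_sum)
qed (use assms in auto)

lemma powr_half_integers:
  fixes z :: complex assumes z: "z \<noteq> 0"
  shows "z powr (1/2) = csqrt z" "z powr (3/2) = z * csqrt z" "z powr (- (1/2)) = 1 / csqrt z"
    "z powr (- (3/2)) = 1 / (z * csqrt z)"
proof -
  show 1: "z powr (1/2) = csqrt z" using z by (simp add: csqrt_conv_powr)
  have "z powr (1 + 1/2) = z powr 1 * z powr (1/2)" by (rule powr_add)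
  thus 2: "z powr (3/2) = z * csqrt z" using z by (simp add: 1)
  show "z powr (- (1/2)) = 1 / csqrt z" "z powr (- (3/2)) = 1 / (z * csqrt z)"
    using 1 2 by (simp_all only: powr_minus inverse_eq_divide)
qed

section \<open>Lateral Borel sums and their mean\<close>

lemma csqrt_minus_i_times:
  assumes "r > 0" shows "csqrt (- \<i> / of_real r) = 1 / csqrt (\<i> * of_real r)"
proof (rule csqrt_unique)
  have "csqrt (\<i> * of_real r) ^ 2 = \<i> * of_real r" by simp
  thus "(1 / csqrt (\<i> * of_real r))^2 = - \<i> / of_real r"
    unfolding power_divide using assms by (simp add: field_simps)
  show "0 < Re (1 / csqrt (\<i> * of_real r)) \<or> Re (1 / csqrt (\<i> * of_real r)) = 0 \<and> 0 \<le> Im (1 / csqrt (\<i> * of_real r))"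
  proof -
    have "Re (1 / w) = Re w / norm w ^ 2" for w by (simp add: Re_divide cmod_power2)
    moreover have "Re (csqrt (\<i> * of_real r)) > 0" unfolding csqrt_i_times[OF assms] using assms by simp
    moreover from this have "norm (csqrt (\<i> * of_real r))^2 > 0" by auto
    ultimately show ?thesis by simp
  qed
qed

text \<open>The principal root is multiplicative here because the sum of the arguments \<open>\<pi>/4\<close> and \<open>y\<close> stays between
  \<open>- \<pi>/2\<close> and \<open>\<pi>/2\<close>.\<close>

lemma csqrt_i_times_square:
  assumes "r > 0" "s > 0" "\<bar>y\<bar> < pi / 4"
  shows "csqrt (\<i> * of_real r * (of_real s * cis y)^2) = csqrt (\<i> * of_real r) * (of_real s * cis y)"
proof (rule csqrt_unique)
  show "(csqrt (\<i> * of_real r) * (of_real s * cis y))^2 = \<i> * of_real r * (of_real s * cis y)^2"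
    by (simp add: power_mult_distrib)
  have "cos (y + pi / 4) > 0" using assms by (intro cos_gt_zero_pi) auto
  hence "cos y - sin y > 0" by (simp add: cos_add cos_45 sin_45 flip: left_diff_distrib)
  hence "sqrt (r / 2) * s * (cos y - sin y) > 0" using assms by (intro mult_pos_pos) auto
  also have "sqrt (r / 2) * s * (cos y - sin y) = Re (csqrt (\<i> * of_real r) * (of_real s * cis y))"
    unfolding csqrt_i_times[OF assms(1)] by (simp add: algebra_simps)
  finally show "0 < Re (csqrt (\<i> * of_real r) * (of_real s * cis y)) \<or>
    Re (csqrt (\<i> * of_real r) * (of_real s * cis y)) = 0 \<and> 0 \<le> Im (csqrt (\<i> * of_real r) * (of_real s * cis y))" by simp
qed

text \<open>With \<open>b \<xi> = u\<^sup>2\<close>, that is \<open>\<xi> = i (\<pi> / 2 N) u\<^sup>2\<close>, the ray at angle \<open>\<pi>/2 + t\<close> in the \<open>\<xi>\<close>-plane becomes the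
  ray at angle \<open>t/2\<close> in the \<open>u\<close>-plane, the Laplace kernel \<open>exp (- \<xi> / \<tau>)\<close> becomes a Gaussian, and the
  fractional powers of \<open>b\<close> and \<open>\<xi>\<close> combine to the integral power in \<open>borel_density\<close>. The sign of \<open>t\<close> selects
  the lateral sum.\<close>

lemma lateral_borel_sum:
  fixes N \<nu> k :: nat and t :: real and \<tau> :: complex
  assumes N: "N \<ge> 1" and \<nu>: "\<nu> \<le> 1" and k: "k \<in> index_set \<nu> N" and t: "t \<noteq> 0" "\<bar>t\<bar> < pi / 2"
  defines "x \<equiv> pi * real k / real N" and "\<omega> \<equiv> cis (t / 2)" and "c \<equiv> \<i> * of_real (pi / (2 * real N)) / \<tau>"
    and "\<eta> \<equiv> 3/2 - real \<nu>"
  assumes int: "set_integrable lborel {0..} (\<lambda>s. exp (- (c * (of_real s * \<omega>)^2)) * borel_density \<nu> x (of_real s * \<omega>) * \<omega>)"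
  shows "borel_summable (pi / 2 + t) \<eta> (EI_series \<nu> N k) \<tau>"
    and "borel_sum (pi / 2 + t) \<eta> (EI_series \<nu> N k) \<tau> = \<tau> powr (- of_real \<eta>) * (2 * EI_prefactor \<nu> N *
           (LINT s:{0..}|lborel. exp (- (c * (of_real s * \<omega>)^2)) * borel_density \<nu> x (of_real s * \<omega>) * \<omega>))"
proof -
  define \<kappa> where "\<kappa> = pi / (2 * real N)"
  define \<beta> where "\<beta> = \<i> * of_real \<kappa>"
  define b where "b = 2 * of_nat N / (of_real pi * \<i>)"
  define A where "A = EI_prefactor \<nu> N"
  define K where "K = A * b powr (3/2 - of_nat \<nu>)"
  define F where "F = borel_fps \<eta> (EI_series \<nu> N k)"
  define \<rho> where "\<rho> = csqrt \<beta>"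
  have \<kappa>: "\<kappa> > 0" using N by (simp add: \<kappa>_def)
  have kN: "k \<le> N" "\<nu> = 1 \<Longrightarrow> k \<ge> 1"
    using k N \<nu> by (auto simp: index_set_def split: if_splits)
  have x: "\<nu> = 0 \<or> 0 < x" "x \<le> pi"
    using kN N \<nu> by (auto simp: x_def field_simps le_Suc_eq)
  have \<beta>0: "\<beta> \<noteq> 0" "\<rho> \<noteq> 0" using \<kappa> by (simp_all add: \<beta>_def \<rho>_def)
  have b\<beta>: "b = 1 / \<beta>" "b = - \<i> / of_real \<kappa>" using N by (simp_all add: b_def \<beta>_def \<kappa>_def field_simps)
  have \<rho>2: "\<rho>^2 = \<beta>" by (simp add: \<rho>_def)
  have csb: "csqrt b = 1 / \<rho>" unfolding b\<beta>(2) csqrt_minus_i_times[OF \<kappa>] \<rho>_def \<beta>_def ..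
  have cont: "continues_on F {\<xi>. b * \<xi> \<in> slit_plane} (\<lambda>\<xi>. K * borel_kernel (fourier_coeff \<nu> x) (b * \<xi>))"
    by (rule continues_on_borel_kernel[OF norm_fourier_coeff_le summable_fourier_coeff[OF x]])
       (simp only: F_def K_def A_def \<eta>_def b_def x_def borel_fps_EI_series[OF N \<nu> k])
  have cis2: "cis (pi / 2 + t) = \<i> * \<omega>^2"
    by (simp add: \<omega>_def power2_eq_square cis_mult flip: cis_mult[of "pi/2"])
  have \<xi>: "of_real (\<kappa> * s^2) * cis (pi / 2 + t) = \<beta> * (of_real s * \<omega>)^2" for s
    unfolding cis2 \<beta>_def by (simp add: power_mult_distrib)
  have \<omega>0: "Im \<omega> \<noteq> 0" "Re \<omega> \<noteq> 0" "\<omega> \<noteq> 0"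
  proof -
    have "cos (t / 2) > 0" using t by (intro cos_gt_zero_pi) auto
    thus "Re \<omega> \<noteq> 0" "\<omega> \<noteq> 0" by (auto simp: \<omega>_def)
    have "sin (t / 2) \<noteq> 0"
      using t sin_gt_zero[of "t / 2"] sin_gt_zero[of "- t / 2"] by (cases "t > 0") auto
    thus "Im \<omega> \<noteq> 0" by (simp add: \<omega>_def)
  qed
  have star: "b * (\<beta> * (of_real s * \<omega>)^2) = (of_real s * \<omega>)^2" "(of_real s * \<omega>)^2 \<in> slit_plane" for s
    using \<beta>0 ray_square_slit_plane[OF \<omega>0(1,2)] by (simp_all add: b\<beta>(1))
  have eval: "continuation F (\<beta> * (of_real s * \<omega>)^2) = K * borel_kernel (fourier_coeff \<nu> x) ((of_real s * \<omega>)^2)" for s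
    using continuation_eqI[OF cont, of "\<beta> * (of_real s * \<omega>)^2"] star[of s] by simp
  define f where "f s = exp (- (c * (of_real s * \<omega>)^2)) * borel_density \<nu> x (of_real s * \<omega>) * \<omega>" for s
  have fg: "(2 * \<kappa> * s) *\<^sub>R laplace_integrand (pi / 2 + t) \<eta> (EI_series \<nu> N k) \<tau> (\<kappa> * s^2) = 2 * A * f s"
    if s: "s > 0" for s
  proof -
    define u where "u = of_real s * \<omega>"
    have u0: "u \<noteq> 0" using s \<omega>0 by (simp add: u_def)
    define G where "G = exp (- (c * u^2)) * borel_kernel (fourier_coeff \<nu> x) (u^2)"
    have csx: "csqrt (\<beta> * u^2) = \<rho> * u"
      unfolding \<beta>_def u_def \<rho>_def \<omega>_def by (rule csqrt_i_times_square) (use \<kappa> s t in auto)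
    have e: "- (\<beta> * u^2) / \<tau> = - (c * u^2)" by (simp add: c_def \<beta>_def \<kappa>_def)
    have "laplace_integrand (pi / 2 + t) \<eta> (EI_series \<nu> N k) \<tau> (\<kappa> * s^2)
       = exp (- (\<beta> * u^2) / \<tau>) * ((\<beta> * u^2) powr of_real (\<eta> - 1) * (K * borel_kernel (fourier_coeff \<nu> x) (u^2))) * (\<i> * \<omega>^2)"
      unfolding laplace_integrand_def borel_transform_def F_def[symmetric] \<xi> u_def[symmetric] eval[of s, folded u_def]
      unfolding cis2 ..
    hence L: "laplace_integrand (pi / 2 + t) \<eta> (EI_series \<nu> N k) \<tau> (\<kappa> * s^2)
       = G * ((\<beta> * u^2) powr of_real (\<eta> - 1) * K) * (\<i> * \<omega>^2)"
      unfolding e G_def by (simp only: mult_ac)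
    have scale: "(2 * \<kappa> * s) *\<^sub>R (\<i> * \<omega>^2) = 2 * \<beta> * u * \<omega>"
      by (simp add: scaleR_conv_of_real \<beta>_def u_def power2_eq_square)
    have pow: "(\<beta> * u^2) powr of_real (\<eta> - 1) * K * (2 * \<beta> * u * \<omega>) = 2 * A * u^(2 - 2 * \<nu>) * \<omega>"
    proof -
      have nz: "\<beta> * u^2 \<noteq> 0" "b \<noteq> 0" using u0 \<beta>0 by (auto simp: b\<beta>(1))
      consider "\<nu> = 0" | "\<nu> = 1" using \<nu> by linarith
      thus ?thesis
      proof cases
        case 1
        hence "of_real (\<eta> - 1) = (1/2 :: complex)" "3/2 - of_nat \<nu> = (3/2 :: complex)" by (simp_all add: \<eta>_def)
        hence "(\<beta> * u^2) powr of_real (\<eta> - 1) * K * (2 * \<beta> * u * \<omega>)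
            = \<rho> * u * (A * (b * (1 / \<rho>))) * (2 * \<beta> * u * \<omega>)"
          unfolding K_def using powr_half_integers(1)[OF nz(1)] powr_half_integers(2)[OF nz(2)] csx csb
          by (simp only:)
        also have "\<dots> = 2 * A * u^2 * \<omega>" using \<beta>0 by (simp add: b\<beta>(1) power2_eq_square)
        finally show ?thesis using 1 by simp
      next
        case 2
        hence "of_real (\<eta> - 1) = (- (1/2) :: complex)" "3/2 - of_nat \<nu> = (1/2 :: complex)" by (simp_all add: \<eta>_def)
        hence "(\<beta> * u^2) powr of_real (\<eta> - 1) * K * (2 * \<beta> * u * \<omega>) = 1 / (\<rho> * u) * (A * (1 / \<rho>)) * (2 * \<rho>^2 * u * \<omega>)"
          unfolding K_def using powr_half_integers(3)[OF nz(1)] powr_half_integers(1)[OF nz(2)] csx csb \<rho>2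
          by (simp only:)
        also have "\<dots> = 2 * A * \<omega>" using u0 \<beta>0 by (simp add: power2_eq_square)
        finally show ?thesis using 2 by simp
      qed
    qed
    have "(2 * \<kappa> * s) *\<^sub>R laplace_integrand (pi / 2 + t) \<eta> (EI_series \<nu> N k) \<tau> (\<kappa> * s^2)
        = G * ((\<beta> * u^2) powr of_real (\<eta> - 1) * K * ((2 * \<kappa> * s) *\<^sub>R (\<i> * \<omega>^2)))"
      unfolding L by (simp only: mult_scaleR_right mult.assoc)
    also have "\<dots> = G * (2 * A * u^(2 - 2 * \<nu>) * \<omega>)" unfolding scale pow ..
    also have "\<dots> = 2 * A * f s" unfolding f_def u_def[symmetric] borel_density_def G_def by (simp only: mult_ac)
    finally show ?thesis .
  qed
  have intf: "set_integrable lborel {0..} (\<lambda>s. 2 * A * f s)"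
    unfolding f_def by (intro set_integrable_mult_right int)
  have sub: "set_integrable lborel {0..} (laplace_integrand (pi / 2 + t) \<eta> (EI_series \<nu> N k) \<tau>)"
    "(LINT r:{0..}|lborel. laplace_integrand (pi / 2 + t) \<eta> (EI_series \<nu> N k) \<tau> r) = (LINT s:{0..}|lborel. 2 * A * f s)"
    by (rule set_integral_square_substitution[OF \<kappa> intf], erule fg)+
  have "of_real r * cis (pi / 2 + t) \<in> ml_star F" if "r \<ge> 0" for r
  proof -
    have "r = \<kappa> * sqrt (r / \<kappa>)^2" using that \<kappa> by simp
    hence "of_real r * cis (pi / 2 + t) = \<beta> * (of_real (sqrt (r / \<kappa>)) * \<omega>)^2" using \<xi> by metis
    hence "of_real r * cis (pi / 2 + t) \<in> {\<xi>. b * \<xi> \<in> slit_plane}" by (simp only: mem_Collect_eq star)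
    thus ?thesis unfolding ml_star_def using cont by blast
  qed
  thus "borel_summable (pi / 2 + t) \<eta> (EI_series \<nu> N k) \<tau>"
    unfolding borel_summable_def F_def using sub(1) by blast
  show "borel_sum (pi / 2 + t) \<eta> (EI_series \<nu> N k) \<tau> = \<tau> powr (- of_real \<eta>) * (2 * EI_prefactor \<nu> N *
           (LINT s:{0..}|lborel. exp (- (c * (of_real s * \<omega>)^2)) * borel_density \<nu> x (of_real s * \<omega>) * \<omega>))"
    unfolding borel_sum_def sub(2) by (simp only: set_integral_mult_right f_def A_def)
qed

text \<open>The three square roots combine by \<open>\<surd>(2 i N) \<cdot> \<surd>(i \<pi> / 2 N) = i \<surd>\<pi>\<close>, and the root of \<open>\<tau>\<close> in \<open>\<gamma>\<close> cancels the
  half-integral power of \<open>\<tau>\<close>.\<close>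

lemma EI_prefactor_normalisation:
  assumes N: "N \<ge> 1" and \<nu>: "\<nu> \<le> 1" and \<tau>: "Im \<tau> > 0"
  defines "\<gamma> \<equiv> csqrt (\<i> * of_real (pi / (2 * real N))) / csqrt \<tau>"
  shows "\<tau> powr (- of_real (3/2 - real \<nu>)) * EI_prefactor \<nu> N * (of_real (sqrt pi) / \<gamma>) = 2 / of_real pi * (- \<i> / \<tau>)^(1 - \<nu>)"
proof -
  have \<tau>0: "\<tau> \<noteq> 0" using \<tau> by auto
  define \<rho> where "\<rho> = csqrt (\<i> * of_real (pi / (2 * real N)))"
  define \<zeta> where "\<zeta> = csqrt \<tau>"
  have nz: "\<rho> \<noteq> 0" "\<zeta> \<noteq> 0" using N \<tau>0 by (simp_all add: \<rho>_def \<zeta>_def)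
  have "csqrt (\<i> * of_real (2 * real N)) * \<rho> = of_real (sqrt (2 * real N / 2) * sqrt (pi / (2 * real N) / 2)) * (1 + \<i>)^2"
    unfolding \<rho>_def using N by (subst csqrt_i_times, simp, subst csqrt_i_times, simp, simp only: of_real_mult power2_eq_square mult_ac)
  also have "sqrt (2 * real N / 2) * sqrt (pi / (2 * real N) / 2) = sqrt (pi / 4)"
    using N by (simp flip: real_sqrt_mult)
  also have "sqrt (pi / 4) = sqrt pi / 2" by (simp add: real_sqrt_divide)
  finally have prod: "csqrt (\<i> * of_real (2 * real N)) * \<rho> = of_real (sqrt pi) * \<i>"
    by (simp add: power2_sum)
  define R where "R = csqrt (\<i> * of_real (2 * real N))"
  have R: "R * \<rho> = of_real (sqrt pi) * \<i>" "csqrt (2 * \<i> * of_nat N) = R" using prod by (simp_all add: R_def mult_ac)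
  have R0: "R \<noteq> 0" using R(1) by auto
  have A: "EI_prefactor \<nu> N * (of_real (sqrt pi) / \<gamma>) = 2 / of_real pi * \<zeta> * \<i>^\<nu> * (- \<i>)"
  proof -
    have "EI_prefactor \<nu> N * (of_real (sqrt pi) / \<gamma>) = 2 * \<i>^\<nu> * of_real (sqrt pi) * \<zeta> / (of_real pi * (R * \<rho>))"
      unfolding EI_prefactor_def R(2) \<gamma>_def \<rho>_def[symmetric] \<zeta>_def[symmetric] using nz by (simp add: mult_ac)
    also have "\<dots> = 2 / of_real pi * \<zeta> * \<i>^\<nu> * (- \<i>)"
      unfolding R(1) by (simp add: field_simps)
    finally show ?thesis .
  qed
  consider "\<nu> = 0" | "\<nu> = 1" using \<nu> by linarith
  thus ?thesis
  proof cases
    case 1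
    have "\<tau> powr (- of_real (3/2 - real \<nu>)) = 1 / (\<tau> * \<zeta>)" using powr_half_integers(4)[OF \<tau>0] 1 by (simp add: \<zeta>_def)
    thus ?thesis unfolding mult.assoc A using 1 nz by simp
  next
    case 2
    have "- complex_of_real (3/2 - real \<nu>) = - (1/2)" using 2 by simp
    hence "\<tau> powr (- of_real (3/2 - real \<nu>)) = 1 / \<zeta>" using powr_half_integers(3)[OF \<tau>0] by (simp only: \<zeta>_def)
    thus ?thesis unfolding mult.assoc A using 2 nz by simp
  qed
qed

lemma cone_eventually:
  assumes "\<bar>Im \<gamma>\<bar> < Re \<gamma>"
  shows "\<forall>\<^sub>F \<epsilon> in at_right 0. \<bar>Im (\<gamma> * cis (m * \<epsilon>))\<bar> < Re (\<gamma> * cis (m * \<epsilon>))"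
proof -
  have "((\<lambda>\<epsilon>. Re (\<gamma> * cis (m * \<epsilon>)) - \<bar>Im (\<gamma> * cis (m * \<epsilon>))\<bar>) \<longlongrightarrow>
         Re (\<gamma> * cis (m * 0)) - \<bar>Im (\<gamma> * cis (m * 0))\<bar>) (at_right 0)"
    by (intro tendsto_intros tendsto_cis)
  hence "\<forall>\<^sub>F \<epsilon> in at_right 0. Re (\<gamma> * cis (m * \<epsilon>)) - \<bar>Im (\<gamma> * cis (m * \<epsilon>))\<bar> > 0"
    by (rule order_tendstoD(1)) (use assms in simp)
  thus ?thesis by eventually_elim simp
qed

text \<open>This is where \<open>Im \<tau> > 0\<close> enters the convergence: it makes the real part of \<open>\<gamma>\<^sup>2 = i r / \<tau>\<close> positive, so that the
  Gaussian decays along the real axis and along all nearby rays.\<close>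

lemma csqrt_quotient_cone:
  assumes r: "r > 0" and \<tau>: "Im \<tau> > 0"
  defines "\<gamma> \<equiv> csqrt (\<i> * of_real r) / csqrt \<tau>"
  shows "\<gamma>^2 = \<i> * of_real r / \<tau>" "\<bar>Im \<gamma>\<bar> < Re \<gamma>"
proof -
  define \<zeta> where "\<zeta> = csqrt \<tau>"
  show g2: "\<gamma>^2 = \<i> * of_real r / \<tau>" by (simp add: \<gamma>_def power_divide)
  have \<zeta>2: "\<zeta>^2 = \<tau>" by (simp add: \<zeta>_def)
  have "Im (\<zeta>^2) > 0" unfolding \<zeta>2 by (rule \<tau>)
  hence "Re \<zeta> * Im \<zeta> > 0" by (simp add: Im_power2 mult.commute)
  moreover have "Re \<zeta> \<ge> 0" unfolding \<zeta>_def using csqrt_principal[of \<tau>] by auto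
  ultimately have \<zeta>: "Re \<zeta> > 0" "Im \<zeta> > 0" by (auto simp: zero_less_mult_iff)
  define n where "n = (Re \<zeta>)^2 + (Im \<zeta>)^2"
  have n: "n > 0" using \<zeta> by (simp add: n_def sum_power2_gt_zero_iff)
  define s where "s = sqrt (r / 2)"
  have s: "s > 0" using r by (simp add: s_def)
  have \<gamma>: "\<gamma> = of_real s * (1 + \<i>) / \<zeta>" unfolding \<gamma>_def csqrt_i_times[OF r] s_def \<zeta>_def ..
  have Re: "Re \<gamma> = s * (Re \<zeta> + Im \<zeta>) / n" and Im: "Im \<gamma> = s * (Re \<zeta> - Im \<zeta>) / n"
    unfolding \<gamma> n_def by (simp_all add: Re_divide Im_divide algebra_simps)
  have "\<bar>Im \<gamma>\<bar> = s * \<bar>Re \<zeta> - Im \<zeta>\<bar> / n" unfolding Im using s n by (simp add: abs_mult)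
  also have "\<dots> < Re \<gamma>" unfolding Re using s n \<zeta> by (intro divide_strict_right_mono mult_strict_left_mono) auto
  finally show "\<bar>Im \<gamma>\<bar> < Re \<gamma>" .
qed

theorem proposition4p10:
  fixes N \<nu> :: nat and \<tau> :: complex
  assumes "N \<ge> 1" and "\<nu> \<in> {0, 1}" and "Im \<tau> > 0"
  shows "\<forall>k\<in>index_set \<nu> N.
           has_median_sum (pi / 2) (3/2 - real \<nu>) (EI_series \<nu> N k) \<tau>
             (EI \<nu> N k \<tau> - (if \<nu> = 0 then \<i> / (of_real pi * \<tau>) else 0))"
proof
  fix k assume k: "k \<in> index_set \<nu> N"
  have N: "N \<ge> 1" and \<nu>: "\<nu> \<le> 1" and \<tau>: "Im \<tau> > 0" using assms by auto
  define r where "r = pi / (2 * real N)"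
  define \<gamma> where "\<gamma> = csqrt (\<i> * of_real r) / csqrt \<tau>"
  define x where "x = pi * real k / real N"
  define \<eta> where "\<eta> = 3/2 - real \<nu>"
  define V where "V = \<tau> powr (- of_real \<eta>) * EI_prefactor \<nu> N"
  have r: "r > 0" using N by (simp add: r_def)
  have \<tau>0: "\<tau> \<noteq> 0" using \<tau> by auto
  note \<gamma> = csqrt_quotient_cone[OF r \<tau>, folded \<gamma>_def]
  have kN: "k \<le> N" "\<nu> = 1 \<Longrightarrow> k \<ge> 1"
    using k N \<nu> by (auto simp: index_set_def split: if_splits)
  have x: "0 \<le> x" "x \<le> pi" "\<nu> = 0 \<or> 0 < x"
    using kN N \<nu> by (auto simp: x_def field_simps le_Suc_eq)
  define S where "S = EI \<nu> N k \<tau> - (if \<nu> = 0 then \<i> / (of_real pi * \<tau>) else 0)"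
  define q where "q n = exp (of_real pi * \<i> * \<tau> * of_nat n ^ 2 / (2 * of_nat N))" for n :: nat
  have V: "V * (of_real (sqrt pi) / \<gamma>) = 2 / of_real pi * (- \<i> / \<tau>)^(1 - \<nu>)"
    unfolding V_def \<eta>_def \<gamma>_def r_def by (rule EI_prefactor_normalisation[OF N \<nu> \<tau>])
  \<comment> \<open>each wave contributes one term of the Eichler integral\<close>
  have line: "V * (of_real pi / 2 * \<i>^(1 - \<nu>) * gaussian_line_integral (1 - \<nu>) \<gamma> (of_real (pi * real n / real N)))
      = of_nat n ^ (1 - \<nu>) * q n" for n
  proof -
    define y :: complex where "y = of_real (pi * real n / real N)"
    have g: "2 * \<gamma>^2 = \<i> * of_real pi / (of_nat N * \<tau>)" "4 * \<gamma>^2 = 2 * \<i> * of_real pi / (of_nat N * \<tau>)"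
      unfolding \<gamma>(1) r_def using N by (simp_all add: field_simps)
    have "- (y^2) / (4 * \<gamma>^2) = of_real pi * \<i> * \<tau> * of_nat n ^ 2 / (2 * of_nat N)"
      unfolding g y_def using N \<tau>0 by (simp add: field_simps power2_eq_square)
    hence "V * (of_real pi / 2 * \<i>^(1 - \<nu>) * gaussian_line_integral (1 - \<nu>) \<gamma> y)
        = (V * (of_real (sqrt pi) / \<gamma>)) * (of_real pi / 2 * \<i>^(1 - \<nu>) * (\<i> * y / (2 * \<gamma>^2))^(1 - \<nu>) * q n)"
      unfolding gaussian_line_integral_def q_def by (simp add: mult_ac)
    also have "\<dots> = (- \<i> / \<tau> * \<i> * (\<i> * y / (2 * \<gamma>^2)))^(1 - \<nu>) * q n"
      unfolding V power_mult_distrib by simp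
    also have "- \<i> / \<tau> * \<i> * (\<i> * y / (2 * \<gamma>^2)) = of_nat n"
      unfolding g y_def using N \<tau>0 by (simp add: field_simps)
    finally show ?thesis unfolding y_def .
  qed
  have const: "V * ((if \<nu> = 0 then 1/2 else 0) * gaussian_line_integral 0 \<gamma> 0) = - (if \<nu> = 0 then \<i> / (of_real pi * \<tau>) else 0)"
  proof -
    have "V * ((if \<nu> = 0 then 1/2 else 0) * gaussian_line_integral 0 \<gamma> 0) = (if \<nu> = 0 then 1/2 else 0) * (V * (of_real (sqrt pi) / \<gamma>))"
      by (simp add: gaussian_line_integral_def)
    thus ?thesis unfolding V by simp
  qed
  \<comment> \<open>the frequencies of the two families of waves are \<open>\<pi> n / N\<close>, with \<open>n\<close> in the two progressions of \<open>EI_sums\<close>\<close>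
  have y1: "2 * pi * real j + x = pi * real (2 * N * j + k) / real N" for j
    using N by (simp add: x_def field_simps)
  have y2: "2 * pi * real (Suc j) - x = pi * real (2 * N * Suc j - k) / real N" for j
  proof -
    have "k \<le> 2 * N * Suc j" using kN(1) by (simp add: trans_le_add1)
    thus ?thesis using N by (simp add: x_def of_nat_diff field_simps)
  qed
  define D where "D J = (if \<nu> = 0 then 1/2 else 0) * gaussian_line_integral 0 \<gamma> 0 + of_real pi / 2 * \<i>^(1 - \<nu>) *
           (\<Sum>j<J. gaussian_line_integral (1 - \<nu>) \<gamma> (of_real (2 * pi * real j + x))
                 + (-1)^\<nu> * gaussian_line_integral (1 - \<nu>) \<gamma> (of_real (2 * pi * real (Suc j) - x)))" for J
  have VD: "V * D J = - (if \<nu> = 0 then \<i> / (of_real pi * \<tau>) else 0) +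
     (\<Sum>j<J. of_nat (2 * N * j + k) ^ (1 - \<nu>) * q (2 * N * j + k)
            + (-1)^\<nu> * (of_nat (2 * N * Suc j - k) ^ (1 - \<nu>) * q (2 * N * Suc j - k)))" for J
    unfolding D_def y1 y2 const[symmetric] line[symmetric]
    by (simp only: distrib_left sum_distrib_left mult_ac)
  have "(\<lambda>J. V * D J) \<longlonglongrightarrow> - (if \<nu> = 0 then \<i> / (of_real pi * \<tau>) else 0) + EI \<nu> N k \<tau>"
    unfolding VD using EI_sums[OF N \<nu> k \<tau>] unfolding sums_def q_def by (intro tendsto_add tendsto_const)
  hence limS: "(\<lambda>J. V * D J) \<longlonglongrightarrow> S" by (simp add: S_def)
  have "\<forall>\<^sub>F \<epsilon>::real in at_right 0. \<epsilon> > 0" by (rule eventually_at_right_less)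
  moreover have "\<forall>\<^sub>F \<epsilon>::real in at_right 0. \<epsilon> < pi / 2"
    using eventually_at_right_real[of 0 "pi / 2"] by (auto elim: eventually_mono)
  moreover note cone_eventually[OF \<gamma>(2), of "1/2"] cone_eventually[OF \<gamma>(2), of "-1/2"]
  ultimately show "has_median_sum (pi / 2) (3/2 - real \<nu>) (EI_series \<nu> N k) \<tau>
             (EI \<nu> N k \<tau> - (if \<nu> = 0 then \<i> / (of_real pi * \<tau>) else 0))"
    unfolding has_median_sum_def S_def[symmetric] \<eta>_def[symmetric]
  proof eventually_elim
    case (elim \<epsilon>)
    define \<omega> where "\<omega> = cis (\<epsilon> / 2)"
    define \<omega>' where "\<omega>' = cis (- \<epsilon> / 2)"
    have cone: "\<bar>Im (\<gamma> * \<omega>)\<bar> < Re (\<gamma> * \<omega>)" "\<bar>Im (\<gamma> * \<omega>')\<bar> < Re (\<gamma> * \<omega>')"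
      using elim(3,4) by (simp_all add: \<omega>_def \<omega>'_def)
    have sc: "sin (\<epsilon> / 2) > 0" "cos (\<epsilon> / 2) > 0"
      using elim(1,2) by (auto intro!: sin_gt_zero cos_gt_zero_pi)
    have \<omega>: "Im \<omega> > 0" "Re \<omega> \<noteq> 0" and \<omega>': "Im \<omega>' < 0" "Re \<omega>' \<noteq> 0"
      using sc by (simp_all add: \<omega>_def \<omega>'_def)
    define I where "I \<omega> = (LINT s:{0..}|lborel. exp (- (\<gamma>^2 * (of_real s * \<omega>)^2)) * borel_density \<nu> x (of_real s * \<omega>) * \<omega>)" for \<omega>
    note bent = bent_line_borel_density[OF cone \<omega> \<omega>' \<nu> x]
    have "(\<lambda>J. V * D J) \<longlonglongrightarrow> V * (I \<omega> + I \<omega>')"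
      unfolding D_def I_def by (intro tendsto_mult tendsto_const bent(1))
    hence S: "V * (I \<omega> + I \<omega>') = S" using limS by (rule LIMSEQ_unique)
    have t: "\<epsilon> \<noteq> 0" "\<bar>\<epsilon>\<bar> < pi / 2" "- \<epsilon> \<noteq> 0" "\<bar>- \<epsilon>\<bar> < pi / 2" using elim(1,2) by auto
    have \<omega>'_eq: "cis (- \<epsilon> / 2) = \<omega>'" by (simp add: \<omega>'_def)
    note up = lateral_borel_sum[OF N \<nu> k t(1,2), folded r_def x_def \<omega>_def \<eta>_def, of \<tau>, folded \<gamma>(1), OF bent(2)]
    note lo = lateral_borel_sum[OF N \<nu> k t(3,4), folded r_def x_def \<eta>_def, unfolded \<omega>'_eq, of \<tau>, folded \<gamma>(1), OF bent(3)]
    have "(borel_sum (pi / 2 + \<epsilon>) \<eta> (EI_series \<nu> N k) \<tau> + borel_sum (pi / 2 - \<epsilon>) \<eta> (EI_series \<nu> N k) \<tau>) / 2 = V * (I \<omega> + I \<omega>')"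
      using up(2) lo(2) by (simp add: V_def I_def algebra_simps)
    with up(1) lo(1) S show ?case by simp
  qed
qed

end
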